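(* Let $M$ and $M'$ be matroids on disjoint ground sets such that $M$ has no coloops and $M'$ has no loops. Let $N_1,\ldots,N_s$ be the unlabeled nested matroids of rank $r(M)$ on $|E(M)|$ elements, and let $N'_1,\ldots,N'_t$ be the unlabeled nested matroids of rank $r(M')$ on $|E(M')|$ elements. If $$\mathbb{I}(\mathcal{P}(M))=\sum_{i=1}^{s}a_i\,\mathbb{I}(\mathcal{P}(N_i))\qquad\text{and}\qquad \mathbb{I}(\mathcal{P}(M'))=\sum_{j=1}^{t}b_j\,\mathbb{I}(\mathcal{P}(N'_j)),$$ then $$\mathbb{I}(\mathcal{P}(M\mathbin{\Box} M'))=\sum_{i=1}^{s}\sum_{j=1}^{t}a_ib_j\,\mathbb{I}(\mathcal{P}(N_i\mathbin{\Box} N'_j)).$$ The corresponding statement for (non-symmetrized) indicator functions also holds: if $N_1,\ldots,N_s$ are instead the (labeled) nested matroids of rank $r(M)$ on the set $E(M)$, $N'_1,\ldots,N'_t$ are the nested matroids of rank $r(M')$ on the set $E(M')$, and $\bar{\mathbb{I}}(\mathcal{P}(M))=\sum_i a_i\,\bar{\mathbb{I}}(\mathcal{P}(N_i))$ and $\bar{\mathbb{I}}(\mathcal{P}(M'))=\sum_j b_j\,\bar{\mathbb{I}}(\mathcal{P}(N'_j))$, then $\bar{\mathbb{I}}(\mathcal{P}(M\mathbin{\Box} M'))=\sum_{i,j}a_ib_j\,\bar{\mathbb{I}}(\mathcal{P}(N_i\mathbin{\Box} N'_j))$.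
   Context: All matroids are on finite ground sets. For a matroid $M$ on an $n$-element set $E$ (identified with $[n]$), $\mathcal{P}(M)\subset\mathbb{R}^n$ is the matroid base polytope, the convex hull of the characteristic vectors of the bases of $M$. For $X\subseteq\mathbb{R}^n$, $\bar{\mathbb{I}}(X):\mathbb{R}^n\to\mathbb{R}$ is the indicator function of $X$, and the symmetrized indicator function is $$\mathbb{I}(X)(x_1,\ldots,x_n)=\frac{1}{n!}\sum_{\sigma\in S_n}\bar{\mathbb{I}}(X)(x_{\sigma(1)},\ldots,x_{\sigma(n)}).$$ $\mathbb{I}(\mathcal{P}(M))$ depends only on the isomorphism class of $M$, so it is defined for matroids on any $n$-element ground set and for unlabeled matroids (isomorphism classes of matroids). A cyclic flat of $M$ is a flat that is a (possibly empty) union of circuits; the set of cyclic flats, ordered by inclusion, is a lattice $\mathcal{Z}(M)$. $M$ is nested if $\mathcal{Z}(M)$ is a chain. By a theorem of Derksen and Fink, for a rank-$r$ matroid $M$ on $[n]$ the function $\bar{\mathbb{I}}(\mathcal{P}(M))$ is a unique linear combination (with integer coefficients) of the functions $\bar{\mathbb{I}}(\mathcal{P}(N))$ over nested rank-$r$ matroids $N$ on $[n]$, and likewise $\mathbb{I}(\mathcal{P}(M))$ is a unique linear combination (with integer coefficients) of the functions $\mathbb{I}(\mathcal{P}(N))$ over unlabeled nested rank-$r$ matroids $N$ on $n$ elements; the coefficients $a_i$, $b_j$ are these integers. For matroids $M,N$ on disjoint ground sets, the free product $M\mathbin{\Box}N$ is the matroid on $E(M)\cup E(N)$ whose independent sets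 are the sets $I\cup J$ where $I$ is independent in $M$, $J\subseteq E(N)$, and $|I\cup J|\le r(M)+r_N(J)$. A free product of nested matroids is nested. The free product of unlabeled matroids is formed using representatives on disjoint ground sets. *)

theory Defs
  imports
    "HOL-Analysis.Convex"
    "HOL-Library.Function_Algebras"
    "HOL-Library.Indicator_Function"
    "HOL-Combinatorics.Permutations"
    "HOL-Library.FuncSet"
begin

text \<open>
  The library has no vector space structure on \<^typ>\<open>'a \<Rightarrow> real\<close>; it is needed to
  speak of convex hulls there.
\<close>

instantiation "fun" :: (type, real_vector) real_vector
begin

definition scaleR_fun :: "real \<Rightarrow> ('a \<Rightarrow> 'b) \<Rightarrow> 'a \<Rightarrow> 'b" where
  "scaleR_fun c f = (\<lambda>x. c *\<^sub>R f x)"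

instance
  by standard (auto simp: scaleR_fun_def fun_eq_iff scaleR_add_right scaleR_add_left)

end


section \<open>Matroids\<close>

text \<open>
  Independent sets are subsets of the ground set, so two matroids on \<open>E\<close> are equal as
  matroids on \<open>E\<close> iff the records are equal.
\<close>

record 'a set_system =
  ground :: "'a set"
  indep :: "'a set set"

locale matroid =
  fixes M :: "'a set_system"
  assumes finite_ground: "finite (ground M)"
    and indep_subset_ground: "X \<in> indep M \<Longrightarrow> X \<subseteq> ground M"
    and indep_empty: "{} \<in> indep M"
    and indep_mono: "Y \<in> indep M \<Longrightarrow> X \<subseteq> Y \<Longrightarrow> X \<in> indep M"
    and indep_augment:
      "X \<in> indep M \<Longrightarrow> Y \<in> indep M \<Longrightarrow> card X < card Y \<Longrightarrow> \<exists>e\<in>Y - X. insert e X \<in> indep M"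

definition rank_of :: "'a set_system \<Rightarrow> 'a set \<Rightarrow> nat" where
  "rank_of M X = Max (card ` {I \<in> indep M. I \<subseteq> X})"

definition rank :: "'a set_system \<Rightarrow> nat" where
  "rank M = rank_of M (ground M)"

definition bases :: "'a set_system \<Rightarrow> 'a set set" where
  "bases M = {B \<in> indep M. \<forall>I\<in>indep M. B \<subseteq> I \<longrightarrow> I = B}"

definition circuits :: "'a set_system \<Rightarrow> 'a set set" where
  "circuits M = {C. C \<subseteq> ground M \<and> C \<notin> indep M \<and> (\<forall>D. D \<subset> C \<longrightarrow> D \<in> indep M)}"

definition loops :: "'a set_system \<Rightarrow> 'a set" where
  "loops M = {e \<in> ground M. {e} \<in> circuits M}"

definition coloops :: "'a set_system \<Rightarrow> 'a set" where
  "coloops M = {e \<in> ground M. \<forall>B\<in>bases M. e \<in> B}"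

definition flats :: "'a set_system \<Rightarrow> 'a set set" where
  "flats M = {F. F \<subseteq> ground M \<and> (\<forall>e\<in>ground M - F. rank_of M F < rank_of M (insert e F))}"

definition cyclic_flats :: "'a set_system \<Rightarrow> 'a set set" where
  "cyclic_flats M = {F \<in> flats M. \<exists>\<C>\<subseteq>circuits M. F = \<Union>\<C>}"

definition nested :: "'a set_system \<Rightarrow> bool" where
  "nested M \<longleftrightarrow> chain\<^sub>\<subseteq> (cyclic_flats M)"

definition free_product :: "'a set_system \<Rightarrow> 'a set_system \<Rightarrow> 'a set_system" (infixr \<open>\<box>\<close> 70) where
  "M \<box> N =
    \<lparr>ground = ground M \<union> ground N,
     indep = {I \<union> J | I J. I \<in> indep M \<and> J \<subseteq> ground N \<and> card (I \<union> J) \<le> rank M + rank_of N J}\<rparr>"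

definition isomorphic :: "'a set_system \<Rightarrow> 'b set_system \<Rightarrow> bool" where
  "isomorphic M N \<longleftrightarrow>
    (\<exists>f. bij_betw f (ground M) (ground N) \<and> (\<forall>X\<subseteq>ground M. f ` X \<in> indep N \<longleftrightarrow> X \<in> indep M))"


section \<open>Base polytopes and their indicator functions\<close>

text \<open>
  \<open>\<real>\<^sup>E\<close> is realised as the space of functions that vanish outside \<open>E\<close>.  Base polytopes lie
  in it, so their indicator functions on all of \<^typ>\<open>'a \<Rightarrow> real\<close> are the extensions by zero
  of those on \<open>\<real>\<^sup>E\<close>.
\<close>

definition base_polytope :: "'a set_system \<Rightarrow> ('a \<Rightarrow> real) set" where
  "base_polytope M = convex hull ((\<lambda>B. indicator B) ` bases M)"

definition base_indicator :: "'a set_system \<Rightarrow> ('a \<Rightarrow> real) \<Rightarrow> real" where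
  "base_indicator M = indicator (base_polytope M)"

text \<open>Coordinates of \<open>\<real>\<^sup>n\<close> are numbered from \<open>0\<close> to \<open>n - 1\<close>.\<close>

definition sym_indicator :: "nat \<Rightarrow> (nat \<Rightarrow> real) set \<Rightarrow> (nat \<Rightarrow> real) \<Rightarrow> real" where
  "sym_indicator n X x = 1 / fact n * (\<Sum>\<sigma> | \<sigma> permutes {..<n}. indicator X (\<lambda>i. x (\<sigma> i)))"

text \<open>
  For an arbitrary ground set, the symmetrized indicator function is that of any isomorphic
  matroid on \<open>{..<n}\<close>; see \<open>sym_base_indicator_eq\<close> below for independence of the choice.
\<close>

definition sym_base_indicator :: "'a set_system \<Rightarrow> (nat \<Rightarrow> real) \<Rightarrow> real" where
  "sym_base_indicator M =
    (let n = card (ground M) in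
      the_elem ((\<lambda>N. sym_indicator n (base_polytope N)) `
        {N. matroid N \<and> ground N = {..<n} \<and> isomorphic M N}))"


section \<open>Unlabeled matroids\<close>

text \<open>
  An unlabeled matroid is an isomorphism class of matroids whose ground set is a finite set
  of natural numbers.
\<close>

definition iso_rel :: "(nat set_system \<times> nat set_system) set" where
  "iso_rel = {(M, N). matroid M \<and> matroid N \<and> isomorphic M N}"

type_synonym unlabeled = "nat set_system set"

definition unlabeled_nested :: "nat \<Rightarrow> nat \<Rightarrow> unlabeled set" where
  "unlabeled_nested r n =
    {N. matroid N \<and> nested N \<and> rank N = r \<and> card (ground N) = n} // iso_rel"

definition labeled_nested :: "nat \<Rightarrow> 'a set \<Rightarrow> 'a set_system set" where
  "labeled_nested r E = {N. matroid N \<and> nested N \<and> rank N = r \<and> ground N = E}"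

text \<open>
  See \<open>unlabeled_sym_base_indicator_class\<close> and \<open>unlabeled_free_product_class\<close> below for
  independence of the representatives.
\<close>

definition unlabeled_sym_base_indicator :: "unlabeled \<Rightarrow> (nat \<Rightarrow> real) \<Rightarrow> real" where
  "unlabeled_sym_base_indicator X = the_elem (sym_base_indicator ` X)"

definition unlabeled_free_product :: "unlabeled \<Rightarrow> unlabeled \<Rightarrow> unlabeled"
    (infixr \<open>\<box>\<^sub>u\<close> 70) where
  "X \<box>\<^sub>u Y =
    (\<Union>M\<in>X. \<Union>N\<in>{N \<in> Y. ground M \<inter> ground N = {}}. iso_rel `` {M \<box> N})"


section \<open>Well-definedness\<close>

lemma isomorphic_refl: "isomorphic M M"
  unfolding isomorphic_def by (intro exI[of _ id]) auto

lemma isomorphic_sym: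
  assumes "isomorphic M N"
  shows "isomorphic N M"
proof -
  obtain f where f: "bij_betw f (ground M) (ground N)"
    and i: "\<And>X. X \<subseteq> ground M \<Longrightarrow> f ` X \<in> indep N \<longleftrightarrow> X \<in> indep M"
    using assms unfolding isomorphic_def by blast
  let ?g = "inv_into (ground M) f"
  have "?g ` X \<in> indep M \<longleftrightarrow> X \<in> indep N" if "X \<subseteq> ground N" for X
  proof -
    have "f ` (?g ` X) = X"
      using f that by (simp add: bij_betw_def image_inv_into_cancel)
    moreover have "?g ` X \<subseteq> ground M"
      using f that inv_into_into[of _ f "ground M"] by (fastforce simp: bij_betw_def)
    ultimately show ?thesis using i[of "?g ` X"] by simp
  qed
  then show ?thesis
    unfolding isomorphic_def using bij_betw_inv_into[OF f] by blast
qed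

lemma isomorphic_trans:
  assumes "isomorphic M N" "isomorphic N L"
  shows "isomorphic M L"
proof -
  obtain f where f: "bij_betw f (ground M) (ground N)"
    and i: "\<And>X. X \<subseteq> ground M \<Longrightarrow> f ` X \<in> indep N \<longleftrightarrow> X \<in> indep M"
    using assms(1) unfolding isomorphic_def by blast
  obtain g where g: "bij_betw g (ground N) (ground L)"
    and j: "\<And>X. X \<subseteq> ground N \<Longrightarrow> g ` X \<in> indep L \<longleftrightarrow> X \<in> indep N"
    using assms(2) unfolding isomorphic_def by blast
  have "(g \<circ> f) ` X \<in> indep L \<longleftrightarrow> X \<in> indep M" if "X \<subseteq> ground M" for X
  proof -
    have "f ` X \<subseteq> ground N" using f that by (auto simp: bij_betw_def)
    then show ?thesis using i[OF that] j[of "f ` X"] by (simp add: image_comp)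
  qed
  then show ?thesis
    unfolding isomorphic_def using bij_betw_trans[OF f g] by blast
qed

lemma isomorphic_card: "isomorphic M N \<Longrightarrow> card (ground M) = card (ground N)"
  unfolding isomorphic_def by (auto dest: bij_betw_same_card)

lemma equiv_iso_rel: "equiv {N. matroid N} iso_rel"
  by (rule equivI)
    (auto simp: iso_rel_def refl_on_def sym_def trans_def
      intro: isomorphic_refl isomorphic_sym isomorphic_trans)

text \<open>An isomorphism maps the subsets of the ground sets onto each other.\<close>

lemma iso_indep_image:
  assumes "matroid M" "matroid N" "bij_betw f (ground M) (ground N)"
    and "\<forall>X\<subseteq>ground M. f ` X \<in> indep N \<longleftrightarrow> X \<in> indep M"
  shows "indep N = (\<lambda>X. f ` X) ` indep M"
proof (rule set_eqI, rule iffI)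
  fix Y assume Y: "Y \<in> indep N"
  then have "Y \<subseteq> f ` ground M"
    using matroid.indep_subset_ground[OF assms(2)] assms(3) by (auto simp: bij_betw_def)
  then obtain X where X: "X \<subseteq> ground M" "Y = f ` X" by (meson subset_imageE)
  with Y assms(4) show "Y \<in> (\<lambda>X. f ` X) ` indep M" by auto
next
  fix Y assume "Y \<in> (\<lambda>X. f ` X) ` indep M"
  then show "Y \<in> indep N"
    using assms(4) matroid.indep_subset_ground[OF assms(1)] by auto
qed

lemma iso_rank_of:
  assumes "matroid M" "matroid N" "bij_betw f (ground M) (ground N)"
    and "\<forall>X\<subseteq>ground M. f ` X \<in> indep N \<longleftrightarrow> X \<in> indep M" "X \<subseteq> ground M"
  shows "rank_of N (f ` X) = rank_of M X"
proof -
  have inj: "inj_on f (ground M)" using assms(3) by (simp add: bij_betw_def)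
  have sub: "I \<subseteq> ground M" if "I \<in> indep M" for I
    using that matroid.indep_subset_ground[OF assms(1)] by blast
  have "{I \<in> indep N. I \<subseteq> f ` X} = (\<lambda>I. f ` I) ` {I \<in> indep M. I \<subseteq> X}"
  proof -
    have "f ` I \<subseteq> f ` X \<longleftrightarrow> I \<subseteq> X" if "I \<in> indep M" for I
      using inj_on_image_mem_iff[OF inj _ assms(5)] sub[OF that] by blast
    then show ?thesis unfolding iso_indep_image[OF assms(1-4)] by blast
  qed
  moreover have "card (f ` I) = card I" if "I \<in> indep M" for I
    using card_image[OF inj_on_subset[OF inj sub[OF that]]] .
  ultimately have "card ` {I \<in> indep N. I \<subseteq> f ` X} = card ` {I \<in> indep M. I \<subseteq> X}"
    by (simp add: image_image)
  then show ?thesis by (simp add: rank_of_def)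
qed

context matroid
begin

lemma finite_indep: "X \<in> indep M \<Longrightarrow> finite X"
  using finite_subset indep_subset_ground finite_ground by blast

lemma finite_indep_sets: "finite (indep M)"
  using finite_subset[of "indep M" "Pow (ground M)"] finite_ground indep_subset_ground by blast

lemma card_le_rank_of: "I \<in> indep M \<Longrightarrow> I \<subseteq> X \<Longrightarrow> card I \<le> rank_of M X"
  unfolding rank_of_def using finite_indep_sets by (intro Max_ge) auto

lemma rank_of_basis: "\<exists>I\<in>indep M. I \<subseteq> X \<and> card I = rank_of M X"
proof -
  have "rank_of M X \<in> card ` {I \<in> indep M. I \<subseteq> X}"
    unfolding rank_of_def using finite_indep_sets indep_empty by (intro Max_in) auto
  then show ?thesis by auto
qed

lemma rank_of_mono: "X \<subseteq> Y \<Longrightarrow> rank_of M X \<le> rank_of M Y"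
  using rank_of_basis[of X] card_le_rank_of by fastforce

lemma rank_of_remove:
  assumes "Y \<subseteq> X" "finite X"
  shows "rank_of M X \<le> rank_of M Y + card (X - Y)"
proof -
  obtain I where I: "I \<in> indep M" "I \<subseteq> X" "card I = rank_of M X"
    using rank_of_basis by blast
  have "card (I \<inter> Y) \<le> rank_of M Y"
    using I indep_mono by (intro card_le_rank_of) auto
  moreover have "card (I - Y) \<le> card (X - Y)"
    using I assms by (intro card_mono) auto
  moreover have "card I = card (I \<inter> Y) + card (I - Y)"
    using finite_indep[OF I(1)] by (metis card_Int_Diff)
  ultimately show ?thesis using I by linarith
qed

lemma rank_of_increase:
  assumes "X \<subseteq> Y" "rank_of M X < rank_of M Y"
  shows "\<exists>e\<in>Y - X. rank_of M X < rank_of M (insert e X)"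
proof -
  obtain I where I: "I \<in> indep M" "I \<subseteq> X" "card I = rank_of M X"
    using rank_of_basis by blast
  obtain J where J: "J \<in> indep M" "J \<subseteq> Y" "card J = rank_of M Y"
    using rank_of_basis by blast
  obtain e where e: "e \<in> J - I" "insert e I \<in> indep M"
    using indep_augment[OF I(1) J(1)] I J assms by auto
  have c: "card (insert e I) = Suc (rank_of M X)"
    using e I finite_indep by auto
  have "e \<notin> X" using card_le_rank_of[OF e(2), of X] c I by auto
  moreover have "rank_of M X < rank_of M (insert e X)"
  proof -
    have "insert e I \<subseteq> insert e X" using I by auto
    then show ?thesis using card_le_rank_of[OF e(2), of "insert e X"] c by simp
  qed
  ultimately show ?thesis using e J by auto
qed

end

lemma indep_free_product_iff:
  assumes "matroid M" "matroid N" "ground M \<inter> ground N = {}"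
  shows "X \<in> indep (M \<box> N) \<longleftrightarrow>
    X \<subseteq> ground M \<union> ground N \<and> X \<inter> ground M \<in> indep M \<and>
    card X \<le> rank M + rank_of N (X \<inter> ground N)" (is "_ \<longleftrightarrow> ?R")
proof
  assume "X \<in> indep (M \<box> N)"
  then obtain I J where IJ: "X = I \<union> J" "I \<in> indep M" "J \<subseteq> ground N"
    "card (I \<union> J) \<le> rank M + rank_of N J"
    unfolding free_product_def by auto
  have "I \<subseteq> ground M" using matroid.indep_subset_ground[OF assms(1) IJ(2)] .
  then have "X \<inter> ground M = I" "X \<inter> ground N = J" using IJ assms(3) by auto
  with IJ \<open>I \<subseteq> ground M\<close> show ?R by auto
next
  assume R: ?R
  then have "X = (X \<inter> ground M) \<union> (X \<inter> ground N)" by auto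
  with R have "X = (X \<inter> ground M) \<union> (X \<inter> ground N) \<and> X \<inter> ground M \<in> indep M \<and>
      X \<inter> ground N \<subseteq> ground N \<and>
      card ((X \<inter> ground M) \<union> (X \<inter> ground N)) \<le> rank M + rank_of N (X \<inter> ground N)"
    by auto
  then show "X \<in> indep (M \<box> N)"
    unfolding free_product_def set_system.simps mem_Collect_eq by blast
qed

lemma matroid_free_product:
  assumes M: "matroid M" and N: "matroid N" and d: "ground M \<inter> ground N = {}"
  shows "matroid (M \<box> N)"
proof -
  interpret M: matroid M by fact
  interpret N: matroid N by fact
  note iff = indep_free_product_iff[OF M N d]
  have g: "ground (M \<box> N) = ground M \<union> ground N" by (simp add: free_product_def)
  show ?thesis
  proof
    show fin: "finite (ground (M \<box> N))" using M.finite_ground N.finite_ground g by simp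
    show "X \<in> indep (M \<box> N) \<Longrightarrow> X \<subseteq> ground (M \<box> N)" for X using iff g by simp
    show "{} \<in> indep (M \<box> N)" using iff M.indep_empty by simp
  next
    fix X Y assume Y: "Y \<in> indep (M \<box> N)" and XY: "X \<subseteq> Y"
    have finY: "finite Y"
      using Y iff M.finite_ground N.finite_ground finite_subset[of Y "ground M \<union> ground N"] by auto
    have "X \<inter> ground M \<in> indep M"
      using Y iff XY M.indep_mono[of "Y \<inter> ground M" "X \<inter> ground M"] by auto
    moreover have "card X \<le> rank M + rank_of N (X \<inter> ground N)"
    proof -
      have "rank_of N (Y \<inter> ground N) \<le>
          rank_of N (X \<inter> ground N) + card (Y \<inter> ground N - X \<inter> ground N)"
        using XY finY by (intro N.rank_of_remove) auto
      also have "card (Y \<inter> ground N - X \<inter> ground N) \<le> card (Y - X)"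
        using finY by (intro card_mono) auto
      finally have "rank_of N (Y \<inter> ground N) \<le> rank_of N (X \<inter> ground N) + card (Y - X)"
        by simp
      moreover have "card Y = card X + card (Y - X)"
        using XY finY by (metis card_Diff_subset card_mono finite_subset le_add_diff_inverse)
      moreover have "card Y \<le> rank M + rank_of N (Y \<inter> ground N)" using Y iff by blast
      ultimately show ?thesis by linarith
    qed
    ultimately show "X \<in> indep (M \<box> N)" using Y iff XY by auto
  next
    fix X Y assume X: "X \<in> indep (M \<box> N)" and Y: "Y \<in> indep (M \<box> N)" and c: "card X < card Y"
    have finX: "finite X" and finY: "finite Y"
      using X Y iff M.finite_ground N.finite_ground finite_subset[of _ "ground M \<union> ground N"] by auto
    have cX: "card X \<le> rank M + rank_of N (X \<inter> ground N)"
      and cY: "card Y \<le> rank M + rank_of N (Y \<inter> ground N)" using X Y iff by blast+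
    have addN: "insert e X \<in> indep (M \<box> N)"
      if "e \<in> ground N" "e \<notin> X" "card X < rank M + rank_of N (insert e (X \<inter> ground N))" for e
    proof -
      have "insert e X \<inter> ground M = X \<inter> ground M" "insert e X \<inter> ground N = insert e (X \<inter> ground N)"
        using that d by auto
      then show ?thesis using iff[of "insert e X"] iff[of X] X that finX by auto
    qed
    show "\<exists>e\<in>Y - X. insert e X \<in> indep (M \<box> N)"
    proof (cases "card X < rank M + rank_of N (X \<inter> ground N)")
      case lt: True
      show ?thesis
      proof (cases "Y \<inter> ground N \<subseteq> X")
        case False
        then obtain e where e: "e \<in> Y" "e \<in> ground N" "e \<notin> X" by auto
        have "card X < rank M + rank_of N (insert e (X \<inter> ground N))"
          using lt N.rank_of_mono[OF subset_insertI[of "X \<inter> ground N" e]] by linarith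
        then show ?thesis using addN e by blast
      next
        case True
        have "X = (X \<inter> ground M) \<union> (X \<inter> ground N)" "Y = (Y \<inter> ground M) \<union> (Y \<inter> ground N)"
          using X Y iff by auto
        then have "card X = card (X \<inter> ground M) + card (X \<inter> ground N)"
          "card Y = card (Y \<inter> ground M) + card (Y \<inter> ground N)"
          using card_Un_disjoint[of "X \<inter> ground M" "X \<inter> ground N"]
            card_Un_disjoint[of "Y \<inter> ground M" "Y \<inter> ground N"] finX finY d by auto
        moreover have "card (Y \<inter> ground N) \<le> card (X \<inter> ground N)"
          using True finX by (intro card_mono) auto
        ultimately have "card (X \<inter> ground M) < card (Y \<inter> ground M)" using c by linarith
        then obtain e where e: "e \<in> Y" "e \<in> ground M" "e \<notin> X" "insert e (X \<inter> ground M) \<in> indep M"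
          using M.indep_augment[of "X \<inter> ground M" "Y \<inter> ground M"] X Y iff by auto
        have "insert e X \<inter> ground M = insert e (X \<inter> ground M)" "insert e X \<inter> ground N = X \<inter> ground N"
          using e d by auto
        then have "insert e X \<in> indep (M \<box> N)"
          using iff[of "insert e X"] iff[of X] X e lt finX by auto
        then show ?thesis using e by blast
      qed
    next
      case False
      then have "rank_of N (X \<inter> ground N) < rank_of N (Y \<inter> ground N)"
        using cX cY c by linarith
      also have "\<dots> \<le> rank_of N (X \<inter> ground N \<union> Y \<inter> ground N)"
        by (intro N.rank_of_mono) auto
      finally obtain e where e: "e \<in> Y" "e \<in> ground N" "e \<notin> X"
        "rank_of N (X \<inter> ground N) < rank_of N (insert e (X \<inter> ground N))"
        using N.rank_of_increase[of "X \<inter> ground N" "X \<inter> ground N \<union> Y \<inter> ground N"] by auto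
      then show ?thesis using addN[of e] cX by auto
    qed
  qed
qed

lemma isomorphic_free_product:
  assumes M: "matroid M" "matroid M'" "isomorphic M M'"
    and N: "matroid N" "matroid N'" "isomorphic N N'"
    and d: "ground M \<inter> ground N = {}" "ground M' \<inter> ground N' = {}"
  shows "isomorphic (M \<box> N) (M' \<box> N')"
proof -
  obtain f where f: "bij_betw f (ground M) (ground M')"
      "\<forall>X\<subseteq>ground M. f ` X \<in> indep M' \<longleftrightarrow> X \<in> indep M"
    using M unfolding isomorphic_def by blast
  obtain g where g: "bij_betw g (ground N) (ground N')"
      "\<forall>X\<subseteq>ground N. g ` X \<in> indep N' \<longleftrightarrow> X \<in> indep N"
    using N unfolding isomorphic_def by blast
  define h where "h = (\<lambda>x. if x \<in> ground M then f x else g x)"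
  have h: "bij_betw h (ground M \<union> ground N) (ground M' \<union> ground N')"
    unfolding h_def by (rule bij_betw_disjoint_Un[OF f(1) g(1) d])
  have hM: "h ` X = f ` X" if "X \<subseteq> ground M" for X using that by (force simp: h_def)
  have hN: "h ` X = g ` X" if "X \<subseteq> ground N" for X using that d by (force simp: h_def)
  have inj: "inj_on h (ground M \<union> ground N)" using h by (simp add: bij_betw_def)
  have imgM: "f ` ground M = ground M'" and imgN: "g ` ground N = ground N'"
    using f g by (auto simp: bij_betw_def)
  have rk: "rank M' = rank M"
    using iso_rank_of[OF M(1,2) f, of "ground M"] imgM by (simp add: rank_def)
  have "h ` X \<in> indep (M' \<box> N') \<longleftrightarrow> X \<in> indep (M \<box> N)" if X: "X \<subseteq> ground M \<union> ground N" for X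
  proof -
    have 1: "h ` X \<inter> ground M' = f ` (X \<inter> ground M)"
      using inj_on_image_Int[OF inj X, of "ground M"] hM[of "ground M"] hM[of "X \<inter> ground M"] imgM
      by simp
    have 2: "h ` X \<inter> ground N' = g ` (X \<inter> ground N)"
      using inj_on_image_Int[OF inj X, of "ground N"] hN[of "ground N"] hN[of "X \<inter> ground N"] imgN
      by simp
    have 3: "h ` X \<subseteq> ground M' \<union> ground N'" using h X by (auto simp: bij_betw_def)
    have 4: "card (h ` X) = card X" using card_image[OF inj_on_subset[OF inj X]] .
    have 5: "rank_of N' (g ` (X \<inter> ground N)) = rank_of N (X \<inter> ground N)"
      using iso_rank_of[OF N(1,2) g, of "X \<inter> ground N"] by simp
    have 6: "f ` (X \<inter> ground M) \<in> indep M' \<longleftrightarrow> X \<inter> ground M \<in> indep M" using f(2) by simp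
    show ?thesis
      unfolding indep_free_product_iff[OF M(1) N(1) d(1)] indep_free_product_iff[OF M(2) N(2) d(2)]
        1 2 4 5 6 rk using X 3 by simp
  qed
  then show ?thesis
    unfolding isomorphic_def using h by (intro exI[of _ h]) (simp add: free_product_def)
qed

lemma unlabeled_free_product_class:
  assumes "matroid M" "matroid N" "ground M \<inter> ground N = {}"
  shows "iso_rel `` {M} \<box>\<^sub>u iso_rel `` {N} = iso_rel `` {M \<box> N}"
proof -
  have "iso_rel `` {M' \<box> N'} = iso_rel `` {M \<box> N}"
    if "M' \<in> iso_rel `` {M}" "N' \<in> iso_rel `` {N}" "ground M' \<inter> ground N' = {}" for M' N'
  proof -
    have *: "matroid M'" "matroid N'" "isomorphic M M'" "isomorphic N N'"
      using that by (auto simp: iso_rel_def)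
    have "(M \<box> N, M' \<box> N') \<in> iso_rel"
      using isomorphic_free_product[OF assms(1) *(1,3) assms(2) *(2,4) assms(3) that(3)]
        matroid_free_product[OF assms] matroid_free_product[OF *(1,2) that(3)]
      by (simp add: iso_rel_def)
    then show ?thesis using equiv_class_eq[OF equiv_iso_rel] by metis
  qed
  moreover have "M \<in> iso_rel `` {M}" "N \<in> iso_rel `` {N}"
    using assms by (auto simp: iso_rel_def isomorphic_refl)
  ultimately show ?thesis unfolding unlabeled_free_product_def using assms(3) by blast
qed

lemma matroid_image:
  assumes "matroid M" "inj_on f (ground M)"
  defines "N \<equiv> \<lparr>ground = f ` ground M, indep = (\<lambda>X. f ` X) ` indep M\<rparr>"
  shows "matroid N" "isomorphic M N"
proof -
  interpret M: matroid M by fact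
  have inj: "inj_on f X" if "X \<in> indep M" for X
    using assms(2) M.indep_subset_ground[OF that] inj_on_subset by blast
  show "matroid N"
  proof
    show "finite (ground N)" using M.finite_ground by (simp add: N_def)
    show "X \<in> indep N \<Longrightarrow> X \<subseteq> ground N" for X
      using M.indep_subset_ground by (auto simp: N_def)
    show "{} \<in> indep N" using M.indep_empty by (force simp: N_def)
    show "X \<in> indep N" if "Y \<in> indep N" "X \<subseteq> Y" for X Y
      using that M.indep_mono by (auto simp: N_def elim!: subset_imageE)
  next
    fix X Y assume "X \<in> indep N" "Y \<in> indep N" and c: "card X < card Y"
    then obtain X' Y' where *: "X = f ` X'" "Y = f ` Y'" "X' \<in> indep M" "Y' \<in> indep M"
      by (auto simp: N_def)
    then obtain e where e: "e \<in> Y' - X'" "insert e X' \<in> indep M"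
      using M.indep_augment[of X' Y'] c card_image inj by metis
    have "f e \<notin> f ` X'"
      using e inj_on_insert[of f e X'] inj[OF e(2)] by simp
    moreover have "insert (f e) X \<in> indep N" 
    proof -
      have "insert (f e) X = f ` insert e X'" using * by simp
      then show ?thesis using e(2) unfolding N_def set_system.simps by blast
    qed
    ultimately show "\<exists>e\<in>Y - X. insert e X \<in> indep N" using e(1) *(1,2) by blast
  qed
  have "f ` X \<in> indep N \<longleftrightarrow> X \<in> indep M" if "X \<subseteq> ground M" for X
    using that inj_on_image_eq_iff[OF assms(2) that M.indep_subset_ground]
    by (auto simp: N_def)
  then show "isomorphic M N"
    using assms(2) unfolding isomorphic_def N_def by (intro exI[of _ f]) (simp add: bij_betw_def)
qed

lemma sym_indicator_isomorphic:
  assumes M: "matroid M" "ground M = {..<n}" and N: "matroid N" "ground N = {..<n}"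
    and "isomorphic M N"
  shows "sym_indicator n (base_polytope M) = sym_indicator n (base_polytope N)"
proof -
  obtain f where f: "bij_betw f {..<n} {..<n}"
      "\<forall>X\<subseteq>{..<n}. f ` X \<in> indep N \<longleftrightarrow> X \<in> indep M"
    using assms unfolding isomorphic_def by auto
  define p where "p = (\<lambda>x. if x < n then f x else x)"
  have "bij_betw p {..<n} {..<n}" using f(1) bij_betw_cong[of "{..<n}" p f] by (simp add: p_def)
  then have p: "p permutes {..<n}" by (intro bij_imp_permutes) (auto simp: p_def)
  have pf: "p ` X = f ` X" if "X \<subseteq> {..<n}" for X using that by (force simp: p_def)
  have inj: "inj p" using p permutes_inj by blast
  have bp: "bij_betw p (ground M) (ground N)"
    using \<open>bij_betw p {..<n} {..<n}\<close> assms by simp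
  have iN: "indep N = (\<lambda>X. p ` X) ` indep M"
    using iso_indep_image[OF M(1) N(1) bp] f(2) pf assms by simp
  have bN: "bases N = (\<lambda>X. p ` X) ` bases M"
  proof -
    have "p ` X \<in> bases N \<longleftrightarrow> X \<in> bases M" for X
      unfolding bases_def iN using inj
      by (simp add: inj_image_eq_iff inj_image_subset_iff inj_image_mem_iff inj_on_image)
    moreover have "bases N \<subseteq> (\<lambda>X. p ` X) ` indep M"
      unfolding bases_def iN by auto
    moreover have "bases M \<subseteq> indep M" by (auto simp: bases_def)
    ultimately show ?thesis by blast
  qed
  define T where "T = (\<lambda>x :: nat \<Rightarrow> real. x \<circ> p)"
  have lin: "linear T"
    by (intro linearI) (auto simp: T_def fun_eq_iff scaleR_fun_def)
  have T_ind: "T (indicator (p ` B)) = indicator B" for B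
    using inj by (auto simp: T_def fun_eq_iff indicator_def inj_image_mem_iff)
  have bij: "bij p" using p permutes_bij by blast
  have "T ` base_polytope N = base_polytope M"
    unfolding base_polytope_def convex_hull_linear_image[OF lin] bN
    by (simp add: image_image T_ind)
  moreover have "inj T"
  proof (rule injI)
    fix x y assume "T x = T y"
    then have "x (p i) = y (p i)" for i by (simp add: T_def fun_eq_iff)
    then show "x = y" using bij by (metis bij_pointE ext)
  qed
  ultimately have mem: "x \<circ> p \<in> base_polytope M \<longleftrightarrow> x \<in> base_polytope N" for x
    using inj_image_mem_iff[of T x "base_polytope N"] by (simp add: T_def)
  show ?thesis
  proof
    fix x
    have "(\<Sum>\<sigma> | \<sigma> permutes {..<n}. indicator (base_polytope M) (\<lambda>i. x (\<sigma> i)) :: real) =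
        (\<Sum>\<sigma> | \<sigma> permutes {..<n}. indicator (base_polytope M) (\<lambda>i. x ((\<sigma> \<circ> p) i)))"
      by (rule sum_permutations_compose_right[OF p])
    also have "\<dots> = (\<Sum>\<sigma> | \<sigma> permutes {..<n}. indicator (base_polytope N) (\<lambda>i. x (\<sigma> i)))"
    proof (rule sum.cong)
      fix \<sigma>
      show "indicator (base_polytope M) (\<lambda>i. x ((\<sigma> \<circ> p) i)) =
          (indicator (base_polytope N) (\<lambda>i. x (\<sigma> i)) :: real)"
        using mem[of "\<lambda>i. x (\<sigma> i)"] by (simp add: indicator_def o_def)
    qed simp
    finally show "sym_indicator n (base_polytope M) x = sym_indicator n (base_polytope N) x"
      by (simp add: sym_indicator_def)
  qed
qed

lemma sym_base_indicator_eq: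
  assumes "matroid M" "matroid N" "isomorphic M N" "ground N = {..<card (ground M)}"
  shows "sym_base_indicator M = sym_indicator (card (ground M)) (base_polytope N)"
proof -
  let ?n = "card (ground M)"
  have "(\<lambda>N. sym_indicator ?n (base_polytope N)) `
        {N. matroid N \<and> ground N = {..<?n} \<and> isomorphic M N} =
      {sym_indicator ?n (base_polytope N)}"
  proof -
    have "sym_indicator ?n (base_polytope L) = sym_indicator ?n (base_polytope N)"
      if "matroid L" "ground L = {..<?n}" "isomorphic M L" for L
      using sym_indicator_isomorphic[OF that(1,2) assms(2,4)]
        isomorphic_trans[OF isomorphic_sym[OF that(3)] assms(3)] .
    moreover have "N \<in> {N. matroid N \<and> ground N = {..<?n} \<and> isomorphic M N}"
      using assms by blast
    ultimately show ?thesis by blast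
  qed
  then show ?thesis by (simp add: sym_base_indicator_def)
qed

lemma ex_isomorphic_lessThan:
  assumes "matroid M"
  shows "\<exists>N. matroid N \<and> isomorphic M N \<and> ground N = {..<card (ground M)}"
proof -
  obtain f where f: "bij_betw f (ground M) {..<card (ground M)}"
    using finite_same_card_bij[of "ground M" "{..<card (ground M)}"]
      matroid.finite_ground[OF assms] by auto
  then show ?thesis
    using matroid_image[OF assms, of f]
    by (intro exI[of _ "\<lparr>ground = f ` ground M, indep = (\<lambda>X. f ` X) ` indep M\<rparr>"])
      (auto simp: bij_betw_def)
qed

lemma sym_base_indicator_isomorphic:
  assumes "matroid M" "matroid N" "isomorphic M N"
  shows "sym_base_indicator M = sym_base_indicator N"
proof -
  obtain L where L: "matroid L" "isomorphic N L" "ground L = {..<card (ground N)}"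
    using ex_isomorphic_lessThan[OF assms(2)] by blast
  then show ?thesis
    using sym_base_indicator_eq[OF assms(1) L(1)] sym_base_indicator_eq[OF assms(2) L(1)]
      isomorphic_trans[OF assms(3) L(2)] isomorphic_card[OF assms(3)] by simp
qed

lemma unlabeled_sym_base_indicator_class:
  assumes "matroid M"
  shows "unlabeled_sym_base_indicator (iso_rel `` {M}) = sym_base_indicator M"
proof -
  have "sym_base_indicator ` (iso_rel `` {M}) = {sym_base_indicator M}"
  proof -
    have "M \<in> iso_rel `` {M}" using assms by (simp add: iso_rel_def isomorphic_refl)
    moreover have "sym_base_indicator N = sym_base_indicator M" if "N \<in> iso_rel `` {M}" for N
      using that sym_base_indicator_isomorphic[of M N] by (simp add: iso_rel_def)
    ultimately show ?thesis by blast
  qed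
  then show ?thesis by (simp add: unlabeled_sym_base_indicator_def)
qed

lemma finite_labeled_nested:
  assumes "finite E"
  shows "finite (labeled_nested r E)"
proof -
  have "labeled_nested r E \<subseteq> (\<lambda>I. \<lparr>ground = E, indep = I\<rparr>) ` Pow (Pow E)"
  proof
    fix N assume "N \<in> labeled_nested r E"
    then have "N = \<lparr>ground = E, indep = indep N\<rparr>" "indep N \<in> Pow (Pow E)"
      using matroid.indep_subset_ground by (auto simp: labeled_nested_def)
    then show "N \<in> (\<lambda>I. \<lparr>ground = E, indep = I\<rparr>) ` Pow (Pow E)" by blast
  qed
  then show ?thesis using assms by (simp add: finite_subset)
qed

lemma finite_unlabeled_nested: "finite (unlabeled_nested r n)"
proof -
  let ?S = "(\<lambda>I. \<lparr>ground = {..<n}, indep = I\<rparr>) ` Pow (Pow {..<n})"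
  have "unlabeled_nested r n \<subseteq> (\<lambda>N. iso_rel `` {N}) ` ?S"
  proof
    fix X assume "X \<in> unlabeled_nested r n"
    then obtain M where M: "matroid M" "card (ground M) = n" "X = iso_rel `` {M}"
      by (auto simp: unlabeled_nested_def quotient_def)
    obtain N where N: "matroid N" "isomorphic M N" "ground N = {..<n}"
      using ex_isomorphic_lessThan[OF M(1)] M(2) by auto
    have "X = iso_rel `` {N}"
      using equiv_class_eq[OF equiv_iso_rel, of M N] M N by (simp add: iso_rel_def)
    moreover have "N = \<lparr>ground = {..<n}, indep = indep N\<rparr>" "indep N \<in> Pow (Pow {..<n})"
      using N matroid.indep_subset_ground by auto
    ultimately show "X \<in> (\<lambda>N. iso_rel `` {N}) ` ?S" by blast
  qed
  then show ?thesis by (rule finite_subset) simp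
qed

end

theory Submission
  imports Defs "HOL-Analysis.Function_Topology"
begin

text \<open>
  Write \<open>r\<close> and \<open>r'\<close> for the ranks of \<open>M\<close> and \<open>M'\<close>.  The bases of \<open>M \<box> M'\<close> are the sets
  \<open>I \<union> S\<close> of cardinality \<open>r + r'\<close> with \<open>I\<close> independent in \<open>M\<close> and \<open>S\<close> spanning in \<open>M'\<close>.  The polytopes
  obey the same description (\<open>base_polytope_free_product\<close>): a point lies in the base polytope
  of \<open>M \<box> M'\<close> iff its restriction to the ground set of \<open>M\<close> lies in the independent set polytope of \<open>M\<close>,
  its restriction to the ground set of \<open>M'\<close> lies in the spanning set polytope of \<open>M'\<close>, and its
  coordinates add up to \<open>r + r'\<close>.  So the indicator function of the base polytope of \<open>M \<box> M'\<close> is a product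
  of three factors, one depending only on \<open>M\<close>, one only on \<open>M'\<close>, and one only on \<open>r + r'\<close>.  The only
  content of that description is integrality: cutting the convex hull of 0/1-vectors with
  a hyperplane of constant coordinate sum creates no new vertices, thanks to an exchange property
  (\<open>convex_hull_indicators_slice\<close>).

  Bilinearity then reduces the theorem to one claim: a linear relation between indicator functions of
  base polytopes is inherited by the independent set polytopes and by the spanning set polytopes.
  A nonnegative point \<open>x\<close> lies in the independent set polytope iff the base polytope meets the
  orthant \<open>{w. x \<le> w}\<close>, and intersecting with a fixed convex set preserves linear relations.  Hence
  the claim follows from the existence of the Euler characteristic: if
  \<open>\<Sum>\<^sub>j c\<^sub>j [K\<^sub>j] = 0\<close> for compact convex sets \<open>K\<^sub>j\<close>, then the \<open>c\<^sub>j\<close> of the nonempty \<open>K\<^sub>j\<close> add up to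
  \<open>0\<close> (\<open>indicator_relation_nonempty\<close>).

  A symmetrized relation is a relation between the permuted copies of the polytopes, so it is inherited
  in the same way.  Averaging over the permutations of \<open>E \<union> E'\<close> absorbs an additional average
  over permutations that preserve both \<open>E\<close> and \<open>E'\<close>; this replaces the two factors by their symmetrizations
  (\<open>perm_sum_free_product\<close>), and bilinearity applies again.
\<close>

section \<open>The Euler characteristic of compact convex sets\<close>

text \<open>
  The topology on \<^typ>\<open>'b \<Rightarrow> real\<close> is the product topology, so compactness of convex hulls
  of finite sets has to come from continuity in each coordinate: adding a point \<open>a\<close> to \<open>V\<close> gives a
  continuous image of \<open>{0..1} \<times> (convex hull V)\<close>.
\<close>

lemma compact_convex_hull_finite:
  fixes V :: "('b \<Rightarrow> real) set"
  assumes "finite V"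
  shows "compact (convex hull V)"
  using assms
proof induction
  case empty
  show ?case by simp
next
  case (insert a V)
  show ?case
  proof (cases "V = {}")
    case False
    let ?f = "\<lambda>(u :: real, y :: 'b \<Rightarrow> real) e. u * a e + (1 - u) * y e"
    have cont: "continuous_on ({0..1} \<times> (convex hull V)) ?f"
      unfolding split_def
      by (rule continuous_on_coordinatewise_then_product)
        (intro continuous_intros continuous_on_product_coordinates
          continuous_on_compose2[OF continuous_on_product_coordinates continuous_on_snd]; auto)
    have "convex hull (insert a V) = ?f ` ({0..1} \<times> (convex hull V))"
    proof (rule set_eqI)
      fix x
      have "x \<in> convex hull (insert a V) \<longleftrightarrow>
          (\<exists>u\<ge>0. \<exists>v\<ge>0. \<exists>b. b \<in> convex hull V \<and> u + v = 1 \<and> x = u *\<^sub>R a + v *\<^sub>R b)"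
        unfolding convex_hull_insert[OF False] by blast
      also have "\<dots> \<longleftrightarrow> (\<exists>u\<in>{0..1}. \<exists>b\<in>convex hull V. x = u *\<^sub>R a + (1 - u) *\<^sub>R b)"
        (is "?l \<longleftrightarrow> ?r")
      proof
        assume ?l
        then obtain u v b where *: "0 \<le> u" "0 \<le> v" "b \<in> convex hull V" "u + v = 1"
          "x = u *\<^sub>R a + v *\<^sub>R b" by blast
        then have "v = 1 - u" by simp
        with * show ?r by (intro bexI[of _ u] bexI[of _ b]) auto
      next
        assume ?r
        then obtain u b where "u \<in> {0..1}" "b \<in> convex hull V" "x = u *\<^sub>R a + (1 - u) *\<^sub>R b"
          by blast
        then show ?l by (intro exI[of _ u] exI[of _ "1 - u"] conjI exI[of _ b]) auto
      qed
      also have "\<dots> \<longleftrightarrow> x \<in> ?f ` ({0..1} \<times> (convex hull V))"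
        by (force simp: scaleR_fun_def image_iff)
      finally show "x \<in> convex hull (insert a V) \<longleftrightarrow> x \<in> ?f ` ({0..1} \<times> (convex hull V))" .
    qed
    then show ?thesis
      using compact_continuous_image[OF cont] compact_Times[OF compact_Icc insert.IH] by metis
  qed simp
qed

text \<open>
  The indicator function of a nonempty compact interval jumps down, to the right of a point, exactly
  at the right end of the interval.
\<close>

lemma eventually_indicator_Icc_at_right:
  fixes a b u :: real
  assumes "a \<le> b"
  shows "\<forall>\<^sub>F s in at_right u. indicator {a..b} u - indicator {a..b} s = (of_bool (b = u) :: real)"
proof -
  consider "u < a" | "a \<le> u" "u < b" | "b \<le> u" by linarith
  then show ?thesis
  proof cases
    case 1
    then have "\<forall>\<^sub>F s in at_right u. s \<in> {u<..<a}" by (intro eventually_at_rightI[of _ a]) auto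
    then show ?thesis by eventually_elim (use 1 assms in auto)
  next
    case 2
    then have "\<forall>\<^sub>F s in at_right u. s \<in> {u<..<b}" by (intro eventually_at_rightI[of _ b]) auto
    then show ?thesis by eventually_elim (use 2 in auto)
  next
    case 3
    have "\<forall>\<^sub>F s in at_right u. s \<in> {u<..<u + 1}" by (intro eventually_at_rightI[of _ "u + 1"]) auto
    then show ?thesis by eventually_elim (use 3 assms in \<open>auto simp: indicator_def\<close>)
  qed
qed

lemma compact_convex_real_eq_Icc:
  fixes S :: "real set"
  assumes "compact S" "convex S"
  obtains a b where "S = {a..b}"
proof (cases "S = {}")
  case True
  then show ?thesis using that[of 1 0] by simp
next
  case False
  obtain a where a: "a \<in> S" "\<And>s. s \<in> S \<Longrightarrow> a \<le> s"
    using compact_attains_inf[OF assms(1) False] by blast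
  obtain b where b: "b \<in> S" "\<And>s. s \<in> S \<Longrightarrow> s \<le> b"
    using compact_attains_sup[OF assms(1) False] by blast
  have "{a..b} \<subseteq> S"
  proof
    fix t assume t: "t \<in> {a..b}"
    show "t \<in> S"
    proof (cases "a = b")
      case False
      with t have "(1 - (t - a) / (b - a)) *\<^sub>R a + ((t - a) / (b - a)) *\<^sub>R b \<in> S"
        by (intro convexD_alt[OF assms(2) a(1) b(1)]) (auto simp: divide_simps)
      moreover have segment: "(1 - u) *\<^sub>R a + u *\<^sub>R b = a + u * (b - a)" for u
        by (simp add: algebra_simps)
      have "(1 - (t - a) / (b - a)) *\<^sub>R a + ((t - a) / (b - a)) *\<^sub>R b = t"
        unfolding segment using False by simp
      ultimately show ?thesis by simp
    qed (use t a in auto)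
  qed
  then have "S = {a..b}" using a(2) b(2) by auto
  then show ?thesis by (rule that)
qed

text \<open>
  A nonempty interval is counted once, namely at its right end: by the preceding lemma the coefficients
  of the intervals with right end \<open>u\<close> add up to the jump, to the right of \<open>u\<close>, of the function that is
  assumed to vanish.
\<close>

lemma indicator_relation_nonempty_real:
  fixes c :: "'j \<Rightarrow> real" and K :: "'j \<Rightarrow> real set"
  assumes J: "finite J"
    and cmp: "\<And>j. j \<in> J \<Longrightarrow> compact (K j)" and cnv: "\<And>j. j \<in> J \<Longrightarrow> convex (K j)"
    and zero: "\<And>t. (\<Sum>j\<in>J. c j * indicator (K j) t) = 0"
  shows "(\<Sum>j\<in>J. c j * of_bool (K j \<noteq> {})) = 0"
proof -
  have "\<exists>a b. K j = {a..b}" if "j \<in> J" for j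
    using compact_convex_real_eq_Icc[OF cmp[OF that] cnv[OF that]] by blast
  then obtain a b where K: "\<And>j. j \<in> J \<Longrightarrow> K j = {a j..b j}" by metis
  define J0 where "J0 = {j \<in> J. a j \<le> b j}"
  have J0: "finite J0" "J0 \<subseteq> J" using J by (auto simp: J0_def)
  \<comment> \<open>The coefficients with right end \<open>u\<close> add up to the jump at \<open>u\<close>.\<close>
  have right: "(\<Sum>j | j \<in> J0 \<and> b j = u. c j) = 0" for u
  proof -
    have "\<forall>\<^sub>F s in at_right u. \<forall>j\<in>J0.
        indicator {a j..b j} u - indicator {a j..b j} s = (of_bool (b j = u) :: real)"
      using J0 by (intro eventually_ball_finite ballI eventually_indicator_Icc_at_right)
        (auto simp: J0_def)
    then obtain s where s: "\<And>j. j \<in> J0 \<Longrightarrow>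
        indicator {a j..b j} u - indicator {a j..b j} s = (of_bool (b j = u) :: real)"
      using eventually_happens'[OF trivial_limit_at_right_real] by blast
    have "(\<Sum>j | j \<in> J0 \<and> b j = u. c j) = (\<Sum>j\<in>J0. c j * of_bool (b j = u))"
      unfolding sum.inter_filter[OF J0(1)] by (intro sum.cong) auto
    also have "\<dots> = (\<Sum>j\<in>J0. c j * indicator (K j) u - c j * indicator (K j) s)"
      using J0 by (intro sum.cong refl) (auto simp: K subset_iff right_diff_distrib[symmetric] s)
    also have "\<dots> = (\<Sum>j\<in>J. c j * indicator (K j) u - c j * indicator (K j) s)"
      using J J0 K by (intro sum.mono_neutral_left) (auto simp: J0_def)
    finally show ?thesis using zero by (simp add: sum_subtractf)
  qed
  have "(\<Sum>j\<in>J. c j * of_bool (K j \<noteq> {})) = (\<Sum>j\<in>J0. c j)"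
    using J K by (intro sum.mono_neutral_cong_right) (auto simp: J0_def)
  also have "\<dots> = (\<Sum>u\<in>b ` J0. \<Sum>j | j \<in> J0 \<and> b j = u. c j)"
    by (rule sum.image_gen[OF J0(1)])
  finally show ?thesis using right by simp
qed

text \<open>
  This is the Euler characteristic of compact convex sets in linear form, in Hadwiger's way: by
  induction the claim holds for the slices of the sets on which the coordinate \<open>e\<close> is \<open>t\<close>, which says that the
  images under the projection to \<open>e\<close> satisfy the same relation on the line.  Agreement with a fixed \<open>z\<close>
  outside \<open>A\<close> makes the slices fit the induction hypothesis.
\<close>

lemma indicator_relation_nonempty:
  fixes c :: "'j \<Rightarrow> real" and K :: "'j \<Rightarrow> ('a \<Rightarrow> real) set"
  assumes "finite A" and J: "finite J"
    and "\<And>j. j \<in> J \<Longrightarrow> compact (K j)" and "\<And>j. j \<in> J \<Longrightarrow> convex (K j)"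
    and "\<And>j x e. j \<in> J \<Longrightarrow> x \<in> K j \<Longrightarrow> e \<notin> A \<Longrightarrow> x e = z e"
    and "\<And>x. (\<Sum>j\<in>J. c j * indicator (K j) x) = 0"
  shows "(\<Sum>j\<in>J. c j * of_bool (K j \<noteq> {})) = 0"
  using assms(1,3-)
proof (induction A arbitrary: K z)
  case empty
  have K: "K j \<noteq> {} \<longleftrightarrow> z \<in> K j" if "j \<in> J" for j
  proof -
    have "x = z" if "x \<in> K j" for x using empty.prems(3)[OF \<open>j \<in> J\<close> that] by auto
    then show ?thesis by blast
  qed
  then have "(\<Sum>j\<in>J. c j * of_bool (K j \<noteq> {})) = (\<Sum>j\<in>J. c j * indicator (K j) z)"
    by (intro sum.cong refl) (auto simp: indicator_def)
  then show ?case using empty.prems by simp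
next
  case (insert e A)
  let ?S = "\<lambda>t j. K j \<inter> {x. x e = t}"
  have slice: "(\<Sum>j\<in>J. c j * of_bool (?S t j \<noteq> {})) = 0" for t
  proof (rule insert.IH[where z = "z(e := t)"])
    have "closed {x :: 'a \<Rightarrow> real. x e = t}"
      by (intro closed_Collect_eq continuous_on_product_coordinates continuous_on_const)
    then show "compact (?S t j)" if "j \<in> J" for j
      using insert.prems(1)[OF that] by (rule compact_Int_closed[rotated])
    have "convex {x :: 'a \<Rightarrow> real. x e = t}"
      by (rule convexI) (auto simp: scaleR_fun_def simp flip: distrib_right)
    then show "convex (?S t j)" if "j \<in> J" for j
      using insert.prems(2)[OF that] by (rule convex_Int[rotated])
    show "x e' = (z(e := t)) e'" if "j \<in> J" "x \<in> ?S t j" "e' \<notin> A" for j x e'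
      using that insert.prems(3)[of j x e'] by auto
    show "(\<Sum>j\<in>J. c j * indicator (?S t j) x) = 0" for x
    proof -
      have "(\<Sum>j\<in>J. c j * indicator (?S t j) x) =
          (\<Sum>j\<in>J. c j * indicator (K j) x) * of_bool (x e = t)"
        unfolding sum_distrib_right by (intro sum.cong) (auto simp: indicator_def)
      then show ?thesis using insert.prems(4) by simp
    qed
  qed
  let ?p = "\<lambda>x :: 'a \<Rightarrow> real. x e"
  have "(\<Sum>j\<in>J. c j * of_bool (?p ` K j \<noteq> {})) = 0"
  proof (rule indicator_relation_nonempty_real[OF J])
    show "compact (?p ` K j)" if "j \<in> J" for j
      by (intro compact_continuous_image insert.prems(1)[OF that]
          continuous_on_subset[OF continuous_on_product_coordinates subset_UNIV])
    have "linear ?p" by (rule linearI) (auto simp: scaleR_fun_def)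
    then show "convex (?p ` K j)" if "j \<in> J" for j
      using insert.prems(2)[OF that] convex_linear_image by blast
    have "indicator (?p ` K j) t = (of_bool (?S t j \<noteq> {}) :: real)" for j t
      by (auto simp: indicator_def)
    then show "(\<Sum>j\<in>J. c j * indicator (?p ` K j) t) = 0" for t
      using slice[of t] by simp
  qed
  then show ?case by simp
qed

section \<open>Bases and spanning sets\<close>

context matroid
begin

lemma indep_extends:
  assumes "I \<in> indep M" "I \<subseteq> X"
  shows "\<exists>J\<in>indep M. I \<subseteq> J \<and> J \<subseteq> X \<and> card J = rank_of M X"
proof -
  obtain J where J: "J \<in> indep M" "J \<subseteq> X" "I \<subseteq> J"
    and max: "\<And>K. K \<in> indep M \<Longrightarrow> K \<subseteq> X \<Longrightarrow> J \<subseteq> K \<Longrightarrow> J = K"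
    using finite_has_maximal2[of "{J \<in> indep M. J \<subseteq> X}" I] assms finite_indep_sets by auto
  obtain K where K: "K \<in> indep M" "K \<subseteq> X" "card K = rank_of M X"
    using rank_of_basis by blast
  have "\<not> card J < card K"
  proof
    assume "card J < card K"
    then obtain e where "e \<in> K - J" "insert e J \<in> indep M"
      using indep_augment J K by blast
    then show False using max[of "insert e J"] J K by blast
  qed
  then show ?thesis using J K card_le_rank_of[of J X] by (intro bexI[of _ J]) auto
qed

lemma bases_iff: "B \<in> bases M \<longleftrightarrow> B \<in> indep M \<and> card B = rank M"
proof
  assume B: "B \<in> bases M"
  then obtain J where "J \<in> indep M" "B \<subseteq> J" "card J = rank M"
    using indep_extends[of B "ground M"] indep_subset_ground
    unfolding rank_def bases_def by blast
  with B show "B \<in> indep M \<and> card B = rank M" by (auto simp: bases_def)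
next
  assume B: "B \<in> indep M \<and> card B = rank M"
  then have "I = B" if "I \<in> indep M" "B \<subseteq> I" for I
    using card_subset_eq[OF finite_indep[OF that(1)] that(2)]
      card_le_rank_of[OF that(1) indep_subset_ground[OF that(1)]]
      card_mono[OF finite_indep[OF that(1)] that(2)]
    by (simp add: rank_def)
  with B show "B \<in> bases M" unfolding bases_def by blast
qed

lemma base_above_indep:
  assumes "I \<in> indep M"
  shows "\<exists>B\<in>bases M. I \<subseteq> B"
proof -
  obtain B where "B \<in> indep M" "I \<subseteq> B" "card B = rank_of M (ground M)"
    using indep_extends[OF assms indep_subset_ground[OF assms]] by blast
  then show ?thesis using bases_iff by (auto simp: rank_def)
qed

lemma rank_of_eq_rank_iff:
  assumes "S \<subseteq> ground M"
  shows "rank_of M S = rank M \<longleftrightarrow> (\<exists>B\<in>bases M. B \<subseteq> S)"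
proof
  show "\<exists>B\<in>bases M. B \<subseteq> S" if "rank_of M S = rank M"
    using rank_of_basis[of S] that bases_iff by auto
  show "rank_of M S = rank M" if "\<exists>B\<in>bases M. B \<subseteq> S"
    using that card_le_rank_of[of _ S] rank_of_mono[OF assms] bases_iff
    by (fastforce simp: rank_def)
qed

text \<open>
  The exchange property of independent sets in the dual matroid, stated for spanning sets.  Extend
  \<open>B \<inter> T\<close>, where \<open>B \<subseteq> S\<close> is a basis, to a basis \<open>C \<subseteq> T\<close>.  Every element of \<open>T - S\<close> that \<open>C\<close> misses can be
  removed from \<open>T\<close>, and counting shows that \<open>C\<close> cannot contain all of \<open>T - S\<close>.
\<close>

lemma spanning_remove:
  assumes S: "S \<subseteq> ground M" "rank_of M S = rank M"
    and T: "T \<subseteq> ground M" "rank_of M T = rank M"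
    and less: "card S < card T"
  shows "\<exists>g\<in>T - S. rank_of M (T - {g}) = rank M"
proof -
  have fin: "finite S" "finite T" using S T finite_ground finite_subset by blast+
  obtain B where B: "B \<in> bases M" "B \<subseteq> S" using S rank_of_eq_rank_iff by blast
  have "B \<inter> T \<in> indep M" using B bases_iff indep_mono by blast
  then obtain C where C: "C \<in> indep M" "B \<inter> T \<subseteq> C" "C \<subseteq> T" "card C = rank M"
    using indep_extends[of "B \<inter> T" T] T by auto
  have "\<not> T - S \<subseteq> C"
  proof
    assume TS: "T - S \<subseteq> C"
    have "card (T - S) + card (B \<inter> T) = card ((T - S) \<union> (B \<inter> T))"
      using fin B by (intro card_Un_disjoint[symmetric]) auto
    also have "\<dots> \<le> card C" using TS C fin by (intro card_mono finite_indep) auto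
    also have "\<dots> = card (B \<inter> T) + card (B - T)"
      using B bases_iff C(4) card_Int_Diff[of B T] finite_indep by auto
    finally have "card (T - S) \<le> card (S - T)"
      using card_mono[of "S - T" "B - T"] B fin by fastforce
    then show False
      using less card_Int_Diff[OF fin(1), of T] card_Int_Diff[OF fin(2), of S]
      by (simp add: Int_commute)
  qed
  then obtain g where g: "g \<in> T - S" "g \<notin> C" by blast
  then have "C \<in> bases M" "C \<subseteq> T - {g}" using C bases_iff by auto
  then show ?thesis using g(1) T rank_of_eq_rank_iff[of "T - {g}"] by blast
qed

end

text \<open>
  The bases of the free product are the members of cardinality \<open>rank M + rank N\<close>; the whole family is
  easier to handle since the conditions on the two ground sets are independent of each other.
\<close>

definition indep_spanning_sets :: "'a set_system \<Rightarrow> 'a set_system \<Rightarrow> 'a set set" where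
  "indep_spanning_sets M N =
    {X. X \<subseteq> ground M \<union> ground N \<and> X \<inter> ground M \<in> indep M \<and>
      rank_of N (X \<inter> ground N) = rank N}"

locale disjoint_matroids = M: matroid M + N: matroid N
  for M N :: "'a set_system" +
  assumes disjoint: "ground M \<inter> ground N = {}"
begin

lemma card_split:
  assumes "X \<subseteq> ground M \<union> ground N"
  shows "card X = card (X \<inter> ground M) + card (X \<inter> ground N)"
proof -
  have "X = (X \<inter> ground M) \<union> (X \<inter> ground N)" using assms by blast
  moreover have "card ((X \<inter> ground M) \<union> (X \<inter> ground N)) =
      card (X \<inter> ground M) + card (X \<inter> ground N)"
    using M.finite_ground N.finite_ground disjoint by (intro card_Un_disjoint) auto
  ultimately show ?thesis by simp
qed

lemma Un_bases_mem_indep_spanning_sets: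
  assumes "B \<in> bases M" "C \<in> bases N"
  shows "B \<union> C \<in> indep_spanning_sets M N" "card (B \<union> C) = rank M + rank N"
proof -
  have sub: "B \<subseteq> ground M" "C \<subseteq> ground N"
    using assms M.bases_iff N.bases_iff M.indep_subset_ground N.indep_subset_ground by blast+
  then have eq: "(B \<union> C) \<inter> ground M = B" "(B \<union> C) \<inter> ground N = C" using disjoint by auto
  show "B \<union> C \<in> indep_spanning_sets M N"
    unfolding indep_spanning_sets_def mem_Collect_eq eq
    using assms sub N.rank_of_eq_rank_iff[of C] M.bases_iff by blast
  show "card (B \<union> C) = rank M + rank N"
    using card_split[of "B \<union> C"] eq sub assms M.bases_iff N.bases_iff by auto
qed

lemma bases_free_product:
  "bases (M \<box> N) = {X \<in> indep_spanning_sets M N. card X = rank M + rank N}"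
proof -
  interpret P: matroid "M \<box> N"
    using matroid_free_product M.matroid_axioms N.matroid_axioms disjoint .
  note iff = indep_free_product_iff[OF M.matroid_axioms N.matroid_axioms disjoint]
  have rankN: "rank_of N (X \<inter> ground N) \<le> rank N" for X
    unfolding rank_def by (rule N.rank_of_mono) auto
  have mem: "X \<in> indep (M \<box> N)" if "X \<in> indep_spanning_sets M N" "card X = rank M + rank N" for X
    using that by (simp add: iff indep_spanning_sets_def)
  obtain B C where "B \<in> bases M" "C \<in> bases N"
    using M.base_above_indep[OF M.indep_empty] N.base_above_indep[OF N.indep_empty] by blast
  then have "B \<union> C \<in> indep (M \<box> N)" and "card (B \<union> C) = rank M + rank N"
    using Un_bases_mem_indep_spanning_sets mem by blast+
  then have "rank M + rank N \<le> rank (M \<box> N)"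
    unfolding rank_def[of "M \<box> N"] using P.card_le_rank_of P.indep_subset_ground by metis
  moreover obtain D where "D \<in> indep (M \<box> N)" "card D = rank (M \<box> N)"
    using P.rank_of_basis[of "ground (M \<box> N)"] unfolding rank_def by blast
  then have "rank (M \<box> N) \<le> rank M + rank N" using iff[of D] rankN[of D] by simp
  ultimately have rank: "rank (M \<box> N) = rank M + rank N" by simp
  show ?thesis
  proof (intro set_eqI iffI)
    fix X assume "X \<in> bases (M \<box> N)"
    then have "X \<in> indep (M \<box> N)" "card X = rank M + rank N" using P.bases_iff rank by auto
    then show "X \<in> {X \<in> indep_spanning_sets M N. card X = rank M + rank N}"
      using iff[of X] rankN[of X] by (simp add: indep_spanning_sets_def)
  next
    fix X assume "X \<in> {X \<in> indep_spanning_sets M N. card X = rank M + rank N}"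
    then show "X \<in> bases (M \<box> N)" using mem P.bases_iff rank by simp
  qed
qed

text \<open>
  One of the two ground sets contains more of \<open>Y\<close> than of \<open>X\<close>.  On the ground set of \<open>M\<close>
  independent sets can be augmented and shrunk; on that of \<open>N\<close> spanning sets can be
  shrunk (\<open>spanning_remove\<close>) and enlarged.
\<close>

lemma indep_spanning_sets_exchange:
  assumes X: "X \<in> indep_spanning_sets M N" and Y: "Y \<in> indep_spanning_sets M N"
    and less: "card X < card Y"
  shows "\<exists>g\<in>Y - X. insert g X \<in> indep_spanning_sets M N \<and> Y - {g} \<in> indep_spanning_sets M N"
proof -
  have sub: "X \<subseteq> ground M \<union> ground N" "Y \<subseteq> ground M \<union> ground N"
    and ind: "X \<inter> ground M \<in> indep M" "Y \<inter> ground M \<in> indep M"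
    and span: "rank_of N (X \<inter> ground N) = rank N" "rank_of N (Y \<inter> ground N) = rank N"
    using X Y by (auto simp: indep_spanning_sets_def)
  consider "card (X \<inter> ground M) < card (Y \<inter> ground M)" | "card (X \<inter> ground N) < card (Y \<inter> ground N)"
    using less card_split[OF sub(1)] card_split[OF sub(2)] by linarith
  then show ?thesis
  proof cases
    case 1
    then obtain g where g: "g \<in> Y" "g \<in> ground M" "g \<notin> X" "insert g (X \<inter> ground M) \<in> indep M"
      using M.indep_augment[OF ind] by auto
    have "insert g X \<inter> ground M = insert g (X \<inter> ground M)" "insert g X \<inter> ground N = X \<inter> ground N"
      "(Y - {g}) \<inter> ground M \<subseteq> Y \<inter> ground M" "(Y - {g}) \<inter> ground N = Y \<inter> ground N"
      using g disjoint by auto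
    then show ?thesis
      using g sub span M.indep_mono[OF ind(2)]
      by (intro bexI[of _ g]) (auto simp: indep_spanning_sets_def)
  next
    case 2
    then obtain g where g: "g \<in> Y" "g \<in> ground N" "g \<notin> X"
        "rank_of N (Y \<inter> ground N - {g}) = rank N"
      using N.spanning_remove[OF _ span(1) _ span(2)] by auto
    have eq: "insert g X \<inter> ground M = X \<inter> ground M" "insert g X \<inter> ground N = insert g (X \<inter> ground N)"
      "(Y - {g}) \<inter> ground M = Y \<inter> ground M" "(Y - {g}) \<inter> ground N = Y \<inter> ground N - {g}"
      using g disjoint by auto
    have "rank_of N (insert g (X \<inter> ground N)) = rank N"
    proof (rule antisym)
      show "rank_of N (insert g (X \<inter> ground N)) \<le> rank N"
        unfolding rank_def using g by (intro N.rank_of_mono) auto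
      show "rank N \<le> rank_of N (insert g (X \<inter> ground N))"
        unfolding span(1)[symmetric] by (intro N.rank_of_mono) auto
    qed
    then show ?thesis
      using g sub ind
      by (intro bexI[of _ g]) (auto simp: indep_spanning_sets_def eq)
  qed
qed

end

section \<open>Slices of convex hulls of indicator vectors\<close>

lemma sum_fun_apply: "(\<Sum>i\<in>I. f i) x = (\<Sum>i\<in>I. f i x)" for f :: "'i \<Rightarrow> 'b \<Rightarrow> real"
  by (induction I rule: infinite_finite_induct) auto

lemma convex_hull_image_iff:
  fixes p :: "'i \<Rightarrow> 'b \<Rightarrow> real"
  assumes F: "finite F" and inj: "inj_on p F"
  shows "y \<in> convex hull (p ` F) \<longleftrightarrow>
    (\<exists>u. (\<forall>i\<in>F. 0 \<le> u i) \<and> sum u F = 1 \<and> (\<forall>e. y e = (\<Sum>i\<in>F. u i * p i e)))"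
    (is "?l \<longleftrightarrow> ?r")
proof
  assume ?l
  then obtain v where v: "\<forall>x\<in>p ` F. 0 \<le> v x" "sum v (p ` F) = 1" "(\<Sum>x\<in>p ` F. v x *\<^sub>R x) = y"
    unfolding convex_hull_finite[OF finite_imageI[OF F]] by blast
  have "y = (\<Sum>i\<in>F. v (p i) *\<^sub>R p i)" using v(3) by (simp add: sum.reindex[OF inj])
  then show ?r
    using v(1,2)
    by (intro exI[of _ "\<lambda>i. v (p i)"])
      (simp add: sum.reindex[OF inj] sum_fun_apply scaleR_fun_def)
next
  assume ?r
  then obtain u where u: "\<forall>i\<in>F. 0 \<le> u i" "sum u F = 1" "\<forall>e. y e = (\<Sum>i\<in>F. u i * p i e)"
    by blast
  have "(\<Sum>i\<in>F. u i *\<^sub>R p i) \<in> convex hull (p ` F)"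
    using u by (intro convex_sum[OF F convex_convex_hull]) (auto intro: hull_inc)
  moreover have "y = (\<Sum>i\<in>F. u i *\<^sub>R p i)"
    using u(3) by (auto simp: fun_eq_iff sum_fun_apply scaleR_fun_def)
  ultimately show ?l by simp
qed

lemma inj_indicator: "inj_on (indicator :: 'a set \<Rightarrow> 'a \<Rightarrow> real) F"
proof (rule inj_onI)
  fix X Y :: "'a set" assume "(indicator X :: 'a \<Rightarrow> real) = indicator Y"
  then have "indicator X e = (indicator Y e :: real)" for e by simp
  then have "e \<in> X \<longleftrightarrow> e \<in> Y" for e unfolding indicator_def of_bool_eq_iff .
  then show "X = Y" by blast
qed

lemma sum_indicator_eq_card:
  "finite A \<Longrightarrow> X \<subseteq> A \<Longrightarrow> (\<Sum>e\<in>A. indicator X e) = real (card X)"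
  by (simp add: indicator_def sum.If_cases Int_absorb1)

text \<open>
  Among all ways to write \<open>x\<close> as a convex combination \<open>\<Sum>\<^sub>X u\<^sub>X 1\<^sub>X\<close>, take one that minimizes
  \<open>\<Sum>\<^sub>X u\<^sub>X |X|\<^sup>2\<close>.  The mean of the cardinalities is \<open>k\<close>, so if not all of them are \<open>k\<close>, there are \<open>S\<close> and \<open>T\<close>
  in the combination with \<open>|S| < k < |T|\<close>.  Moving weight from \<open>S\<close> and \<open>T\<close> to \<open>insert g S\<close> and
  \<open>T - {g}\<close> does not change \<open>x\<close>, but it lowers the sum of squares.
\<close>

lemma convex_hull_indicators_slice:
  fixes F :: "'a set set" and x :: "'a \<Rightarrow> real"
  assumes A: "finite A" and FA: "\<And>X. X \<in> F \<Longrightarrow> X \<subseteq> A"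
    and exchange: "\<And>X Y. X \<in> F \<Longrightarrow> Y \<in> F \<Longrightarrow> card X < card Y \<Longrightarrow>
      \<exists>g\<in>Y - X. insert g X \<in> F \<and> Y - {g} \<in> F"
    and x: "x \<in> convex hull (indicator ` F)" and sum: "(\<Sum>e\<in>A. x e) = real k"
  shows "x \<in> convex hull (indicator ` {X \<in> F. card X = k})"
proof -
  have F: "finite F" using A FA by (intro finite_subset[of F "Pow A"]) auto
  have finX: "finite X" if "X \<in> F" for X using A FA[OF that] finite_subset by blast
  \<comment> \<open>The extra coordinate \<open>None\<close> carries the sum of squares that is to be minimized, so that
      compactness of a convex hull provides the minimum.\<close>
  define p :: "'a set \<Rightarrow> 'a option \<Rightarrow> real"
    where "p X = case_option ((real (card X))\<^sup>2) (indicator X)" for X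
  have p: "p X None = (real (card X))\<^sup>2" "p X (Some e) = indicator X e" for X e
    by (simp_all add: p_def)
  have inj: "inj_on p F"
  proof (rule inj_onI)
    fix X Y assume "p X = p Y"
    then have "(indicator X :: 'a \<Rightarrow> real) = indicator Y"
      unfolding fun_eq_iff by (metis p(2))
    then show "X = Y" using inj_onD[OF inj_indicator[of UNIV]] by blast
  qed
  let ?K = "convex hull (p ` F) \<inter> {y. \<forall>e. y (Some e) = x e}"
  have "closed {y :: 'a option \<Rightarrow> real. \<forall>e. y (Some e) = x e}"
    by (intro closed_Collect_all closed_Collect_eq continuous_on_product_coordinates
        continuous_on_const)
  then have "compact ?K"
    using F by (intro compact_Int_closed compact_convex_hull_finite) auto
  moreover have "?K \<noteq> {}"
  proof -
    obtain u where u: "\<forall>X\<in>F. 0 \<le> u X" "sum u F = 1"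
        "\<And>e. x e = (\<Sum>X\<in>F. u X * indicator X e)"
      using x unfolding convex_hull_image_iff[OF F inj_indicator] by blast
    define y where "y o' = (\<Sum>X\<in>F. u X * p X o')" for o'
    have "y \<in> convex hull (p ` F)"
      unfolding convex_hull_image_iff[OF F inj] y_def using u(1,2) by blast
    moreover have "y (Some e) = x e" for e by (simp add: y_def u(3) p)
    ultimately show ?thesis by blast
  qed
  moreover have "continuous_on ?K (\<lambda>y. y None)"
    by (rule continuous_on_subset[OF continuous_on_product_coordinates subset_UNIV])
  ultimately have "\<exists>y\<in>?K. \<forall>z\<in>?K. y None \<le> z None"
    by (rule continuous_attains_inf)
  then obtain y where y: "y \<in> ?K" and min: "\<And>z. z \<in> ?K \<Longrightarrow> y None \<le> z None"
    by blast
  obtain u where u: "\<And>X. X \<in> F \<Longrightarrow> 0 \<le> u X" "sum u F = 1"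
      "\<And>o'. y o' = (\<Sum>X\<in>F. u X * p X o')"
    using y convex_hull_image_iff[OF F inj, of y] by blast
  have xu: "x e = (\<Sum>X\<in>F. u X * indicator X e)" for e
    using y u(3)[of "Some e"] by (simp add: p)
  have "real k = (\<Sum>X\<in>F. u X * (\<Sum>e\<in>A. indicator X e))"
    unfolding sum[symmetric] xu sum_distrib_left by (rule sum.swap)
  also have "\<dots> = (\<Sum>X\<in>F. u X * real (card X))"
    using sum_indicator_eq_card[OF A FA] by (intro sum.cong) auto
  finally have mean: "(\<Sum>X\<in>F. u X * (real (card X) - real k)) = 0"
    by (simp add: right_diff_distrib sum_subtractf u(2) flip: sum_distrib_right)
  have concentrated: "card X = k" if X: "X \<in> F" "u X > 0" for X
  proof (rule ccontr)
    assume neq: "card X \<noteq> k"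
    have below: "\<exists>Y\<in>F. u Y > 0 \<and> card Y < k"
    proof (rule ccontr)
      assume no: "\<not> ?thesis"
      have "\<forall>Y\<in>F. 0 \<le> u Y * (real (card Y) - real k)"
      proof
        fix Y assume "Y \<in> F"
        then have "u Y = 0 \<or> k \<le> card Y" using no u(1)[of Y] by force
        then show "0 \<le> u Y * (real (card Y) - real k)" using u(1)[OF \<open>Y \<in> F\<close>] by auto
      qed
      then have "u X * (real (card X) - real k) = 0"
        using sum_nonneg_0[OF F, of "\<lambda>Y. u Y * (real (card Y) - real k)" X] mean X by simp
      then show False using X neq by simp
    qed
    have above: "\<exists>Y\<in>F. u Y > 0 \<and> k < card Y"
    proof (rule ccontr)
      assume no: "\<not> ?thesis"
      have "\<forall>Y\<in>F. 0 \<le> - (u Y * (real (card Y) - real k))"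
      proof
        fix Y assume "Y \<in> F"
        then have "u Y = 0 \<or> card Y \<le> k" using no u(1)[of Y] by force
        then show "0 \<le> - (u Y * (real (card Y) - real k))"
          using u(1)[OF \<open>Y \<in> F\<close>] by (auto simp: mult_le_0_iff)
      qed
      then have "- (u X * (real (card X) - real k)) = 0"
        using sum_nonneg_0[OF F, of "\<lambda>Y. - (u Y * (real (card Y) - real k))" X] mean X
        by (simp add: sum_negf)
      then show False using X neq by simp
    qed
    obtain S T where S: "S \<in> F" "u S > 0" "card S < k" and T: "T \<in> F" "u T > 0" "k < card T"
      using below above by blast
    obtain g where g: "g \<in> T - S" "insert g S \<in> F" "T - {g} \<in> F"
      using exchange[OF S(1) T(1)] S T by auto
    \<comment> \<open>The largest weight that can be moved.\<close>
    define d where "d = min (u S) (u T)"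
    define v where "v X = u X + d * (of_bool (X = insert g S) + of_bool (X = T - {g})
      - of_bool (X = S) - of_bool (X = T))" for X
    have "d > 0" "S \<noteq> T" using S T by (auto simp: d_def)
    have v_sum: "(\<Sum>X\<in>F. v X * f X) =
        (\<Sum>X\<in>F. u X * f X) + d * (f (insert g S) + f (T - {g}) - f S - f T)"
      for f :: "'a set \<Rightarrow> real"
    proof -
      have pick: "(\<Sum>X\<in>F. d * of_bool (X = Z) * f X) = d * f Z" if "Z \<in> F" for Z
        using sum.delta[OF F, of Z "\<lambda>X. d * f X"] that
        by (simp add: of_bool_def if_distrib if_distribR cong: if_cong)
      have "(\<Sum>X\<in>F. v X * f X) = (\<Sum>X\<in>F. u X * f X)
          + (\<Sum>X\<in>F. d * of_bool (X = insert g S) * f X) + (\<Sum>X\<in>F. d * of_bool (X = T - {g}) * f X)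
          - (\<Sum>X\<in>F. d * of_bool (X = S) * f X) - (\<Sum>X\<in>F. d * of_bool (X = T) * f X)"
        unfolding v_def by (simp add: algebra_simps sum.distrib sum_subtractf)
      then show ?thesis unfolding pick[OF S(1)] pick[OF T(1)] pick[OF g(2)] pick[OF g(3)]
        by (simp add: algebra_simps)
    qed
    define z where "z o' = (\<Sum>X\<in>F. v X * p X o')" for o'
    have "z \<in> convex hull (p ` F)"
    proof -
      have "0 \<le> v X" if "X \<in> F" for X
      proof -
        have "d * of_bool (X = S) + d * of_bool (X = T) \<le> u X"
          using \<open>S \<noteq> T\<close> u(1)[OF that] by (auto simp: d_def)
        moreover have "0 \<le> d * of_bool (X = insert g S) + d * of_bool (X = T - {g})"
          using \<open>d > 0\<close> by simp
        ultimately show ?thesis by (simp add: v_def algebra_simps)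
      qed
      moreover have "sum v F = 1" using v_sum[of "\<lambda>_. 1"] u(2) by simp
      ultimately show ?thesis
        unfolding convex_hull_image_iff[OF F inj] z_def by blast
    qed
    moreover have "z (Some e) = x e" for e
    proof -
      have "indicator (insert g S) e + indicator (T - {g}) e - indicator S e - indicator T e
          = (0 :: real)"
        using g by (auto simp: indicator_def)
      then show ?thesis unfolding z_def v_sum by (simp add: p xu)
    qed
    ultimately have "y None \<le> z None" by (intro min) auto
    moreover have "z None < y None"
    proof -
      have cS: "real (card (insert g S)) = real (card S) + 1"
        using g finX[OF S(1)] by simp
      have cT: "real (card (T - {g})) = real (card T) - 1"
        using g finX[OF T(1)] T by (simp add: card_Diff_singleton)
      have "(real (card S) + 1)\<^sup>2 + (real (card T) - 1)\<^sup>2 - (real (card S))\<^sup>2 - (real (card T))\<^sup>2 =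
          2 * (real (card S) + 1 - real (card T))"
        by (simp add: power2_eq_square algebra_simps)
      also have "\<dots> < 0"
      proof -
        have "card S + 2 \<le> card T" using S(3) T(3) by linarith
        then have "real (card S) + 2 \<le> real (card T)" by linarith
        then show ?thesis by simp
      qed
      finally show ?thesis
        using \<open>d > 0\<close> by (simp add: z_def v_sum p cS cT u(3) mult_pos_neg)
    qed
    ultimately show False by simp
  qed
  let ?G = "{X \<in> F. card X = k}"
  have zero: "u X = 0" if "X \<in> F - ?G" for X
    using that u(1)[of X] concentrated[of X] by fastforce
  have "sum u ?G = 1" using F zero u(2) by (subst sum.mono_neutral_left[of F]) auto
  moreover have "x e = (\<Sum>X\<in>?G. u X * indicator X e)" for e
    unfolding xu using F zero by (intro sum.mono_neutral_right) auto
  moreover have "finite ?G" using F by simp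
  ultimately show ?thesis
    unfolding convex_hull_image_iff[OF \<open>finite ?G\<close> inj_indicator] using u(1) by blast
qed

section \<open>The base polytope of a free product\<close>

lemma fun_upd_mem_convex_hull:
  fixes V :: "('a \<Rightarrow> real) set"
  assumes V: "\<And>v. v \<in> V \<Longrightarrow> v(e := c) \<in> V"
    and y: "y \<in> convex hull V" and t: "min (y e) c \<le> t" "t \<le> max (y e) c"
  shows "y(e := t) \<in> convex hull V"
proof -
  have "convex {y. y(e := c) \<in> convex hull V}"
  proof (rule convexI)
    fix y z :: "'a \<Rightarrow> real" and u v :: real
    assume *: "y \<in> {y. y(e := c) \<in> convex hull V}" "z \<in> {y. y(e := c) \<in> convex hull V}"
      "0 \<le> u" "0 \<le> v" "u + v = 1"
    then have "u *\<^sub>R y(e := c) + v *\<^sub>R z(e := c) \<in> convex hull V"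
      by (intro convexD[OF convex_convex_hull]) auto
    moreover have "u *\<^sub>R y(e := c) + v *\<^sub>R z(e := c) = (u *\<^sub>R y + v *\<^sub>R z)(e := c)"
      using *(5) by (auto simp: fun_eq_iff scaleR_fun_def simp flip: distrib_right)
    ultimately show "u *\<^sub>R y + v *\<^sub>R z \<in> {y. y(e := c) \<in> convex hull V}" by simp
  qed
  moreover have "V \<subseteq> {y. y(e := c) \<in> convex hull V}" using V by (auto intro: hull_inc)
  ultimately have c: "y(e := c) \<in> convex hull V"
    using y hull_minimal[of V "{y. y(e := c) \<in> convex hull V}" convex] by blast
  show ?thesis
  proof (cases "y e = c")
    case True
    then show ?thesis using t c by (simp add: fun_upd_idem)
  next
    case False
    define s where "s = (t - y e) / (c - y e)"
    have s: "0 \<le> s" "s \<le> 1"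
      using t False by (auto simp: s_def divide_simps min_def max_def split: if_splits)
    have "s * (c - y e) = t - y e" using False by (simp add: s_def)
    then have "(1 - s) * y e + s * c = t" by (simp add: algebra_simps)
    then have "(1 - s) *\<^sub>R y + s *\<^sub>R y(e := c) = y(e := t)"
      by (auto simp: fun_eq_iff scaleR_fun_def algebra_simps)
    then show ?thesis using convexD_alt[OF convex_convex_hull y c s] by simp
  qed
qed

text \<open>
  If the generators stay generators when a coordinate \<open>e\<close> is set to \<open>c e\<close>, then coordinates of a point
  of the hull may be moved towards \<open>c\<close>.  With \<open>c = 0\<close> on the ground set of \<open>M\<close> and \<open>c = 1\<close> on that of \<open>N\<close>
  this leads from pairs of base polytope points to all pairs of points of the independent set and spanning set
  polytopes.
\<close>

lemma moved_coordinates_mem_convex_hull: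
  fixes V :: "('a \<Rightarrow> real) set"
  assumes "finite D" and V: "\<And>v e. e \<in> D \<Longrightarrow> v \<in> V \<Longrightarrow> v(e := c e) \<in> V"
    and y: "y \<in> convex hull V"
    and "\<And>e. e \<in> D \<Longrightarrow> min (y e) (c e) \<le> x e \<and> x e \<le> max (y e) (c e)"
    and "\<And>e. e \<notin> D \<Longrightarrow> x e = y e"
  shows "x \<in> convex hull V"
  using assms(1,2,4,5)
proof (induction D arbitrary: x)
  case empty
  then have "x = y" by (intro ext) simp
  then show ?case using y by simp
next
  case (insert e D)
  have "x(e := y e) \<in> convex hull V"
    using insert.hyps insert.prems by (intro insert.IH) auto
  then have "(x(e := y e))(e := x e) \<in> convex hull V"
  proof (rule fun_upd_mem_convex_hull[rotated])
    show "v(e := c e) \<in> V" if "v \<in> V" for v using that by (intro insert.prems(1)) auto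
  qed (use insert.prems(2)[of e] in auto)
  then show ?case by simp
qed

lemma linear_coordinate: "linear (\<lambda>x :: 'a \<Rightarrow> real. x e)"
  by (rule linearI) (auto simp: scaleR_fun_def)

lemma convex_coordinate_le: "convex {x :: 'a \<Rightarrow> real. x e \<le> c}"
  using convex_linear_vimage[OF linear_coordinate convex_real_interval(2)[of c], of e]
  by (simp add: vimage_def)

lemma convex_coordinate_ge: "convex {x :: 'a \<Rightarrow> real. c \<le> x e}"
  using convex_linear_vimage[OF linear_coordinate convex_real_interval(1)[of c], of e]
  by (simp add: vimage_def)

lemma convex_sum_eq: "convex {x :: 'a \<Rightarrow> real. (\<Sum>e\<in>A. x e) = c}"
  by (rule convexI)
    (simp add: scaleR_fun_def sum.distrib flip: sum_distrib_left distrib_right)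

text \<open>
  Restricted to the coordinates in the ground set, this is the independent set polytope; other
  coordinates are unconstrained.
\<close>

definition below_base :: "'a set_system \<Rightarrow> ('a \<Rightarrow> real) \<Rightarrow> bool" where
  "below_base M x \<longleftrightarrow> (\<exists>w\<in>base_polytope M. \<forall>e\<in>ground M. 0 \<le> x e \<and> x e \<le> w e)"

text \<open>
  The spanning set polytope, with unconstrained coordinates outside the ground set.
\<close>

definition above_base :: "'a set_system \<Rightarrow> ('a \<Rightarrow> real) \<Rightarrow> bool" where
  "above_base M x \<longleftrightarrow> (\<exists>w\<in>base_polytope M. \<forall>e\<in>ground M. w e \<le> x e \<and> x e \<le> 1)"

lemma convex_below_base: "convex {x. below_base M x}"
proof (rule convexI)
  fix x y :: "'a \<Rightarrow> real" and u v :: real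
  assume "x \<in> {x. below_base M x}" "y \<in> {x. below_base M x}" and uv: "0 \<le> u" "0 \<le> v" "u + v = 1"
  then obtain w z where w: "w \<in> base_polytope M" "\<And>e. e \<in> ground M \<Longrightarrow> 0 \<le> x e \<and> x e \<le> w e"
    and z: "z \<in> base_polytope M" "\<And>e. e \<in> ground M \<Longrightarrow> 0 \<le> y e \<and> y e \<le> z e"
    by (auto simp: below_base_def)
  have "u *\<^sub>R w + v *\<^sub>R z \<in> base_polytope M"
    using w z uv unfolding base_polytope_def by (intro convexD[OF convex_convex_hull]) auto
  then show "u *\<^sub>R x + v *\<^sub>R y \<in> {x. below_base M x}"
    unfolding below_base_def mem_Collect_eq using w z uv
    by (intro bexI[of _ "u *\<^sub>R w + v *\<^sub>R z"])
      (auto simp: scaleR_fun_def intro!: add_mono mult_left_mono)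
qed

lemma convex_above_base: "convex {x. above_base M x}"
proof (rule convexI)
  fix x y :: "'a \<Rightarrow> real" and u v :: real
  assume "x \<in> {x. above_base M x}" "y \<in> {x. above_base M x}" and uv: "0 \<le> u" "0 \<le> v" "u + v = 1"
  then obtain w z where w: "w \<in> base_polytope M" "\<And>e. e \<in> ground M \<Longrightarrow> w e \<le> x e \<and> x e \<le> 1"
    and z: "z \<in> base_polytope M" "\<And>e. e \<in> ground M \<Longrightarrow> z e \<le> y e \<and> y e \<le> 1"
    by (auto simp: above_base_def)
  have "u *\<^sub>R w + v *\<^sub>R z \<in> base_polytope M"
    using w z uv unfolding base_polytope_def by (intro convexD[OF convex_convex_hull]) auto
  then show "u *\<^sub>R x + v *\<^sub>R y \<in> {x. above_base M x}"
    unfolding above_base_def mem_Collect_eq using w z uv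
    by (intro bexI[of _ "u *\<^sub>R w + v *\<^sub>R z"])
      (auto simp: scaleR_fun_def intro!: add_mono mult_left_mono convex_bound_le)
qed

context matroid
begin

lemma base_polytope_coordinates:
  assumes "w \<in> base_polytope M"
  shows "0 \<le> w e" "w e \<le> 1" "e \<notin> ground M \<Longrightarrow> w e = 0" "(\<Sum>e\<in>ground M. w e) = real (rank M)"
proof -
  have hull: "w \<in> S" if "convex S" "\<And>B. B \<in> bases M \<Longrightarrow> indicator B \<in> S" for S
    using hull_minimal[of "indicator ` bases M" S convex] that assms
    by (auto simp: base_polytope_def)
  have sub: "B \<subseteq> ground M" if "B \<in> bases M" for B
    using that bases_iff indep_subset_ground by blast
  show "0 \<le> w e" using hull[OF convex_coordinate_ge[of 0 e]] by simp
  show "w e \<le> 1" using hull[OF convex_coordinate_le[of e 1]] by (simp add: indicator_def)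
  show "w e = 0" if "e \<notin> ground M"
  proof (rule antisym)
    have "e \<notin> B" if "B \<in> bases M" for B using sub[OF that] \<open>e \<notin> ground M\<close> by blast
    then show "w e \<le> 0" using hull[OF convex_coordinate_le[of e 0]] by simp
    show "0 \<le> w e" by fact
  qed
  show "(\<Sum>e\<in>ground M. w e) = real (rank M)"
    using hull[OF convex_sum_eq[of "ground M" "real (rank M)"]] sub bases_iff
    by (simp add: sum_indicator_eq_card[OF finite_ground])
qed

lemma finite_bases: "finite (bases M)"
  using finite_subset[OF _ finite_indep_sets, of "bases M"] by (auto simp: bases_def)

lemma compact_base_polytope: "compact (base_polytope M)"
  unfolding base_polytope_def using finite_bases by (intro compact_convex_hull_finite) simp

end

context disjoint_matroids
begin

lemma Un_base_polytopes:
  assumes "w \<in> base_polytope M" "z \<in> base_polytope N"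
  shows "w + z \<in> convex hull (indicator ` indep_spanning_sets M N)"
proof -
  have "w + z \<in> convex hull ((\<lambda>B. indicator B) ` bases M + (\<lambda>B. indicator B) ` bases N)"
    unfolding convex_hull_set_plus using assms by (auto simp: base_polytope_def)
  moreover have "indicator B + indicator C \<in> (indicator ` indep_spanning_sets M N :: ('a \<Rightarrow> real) set)"
    if "B \<in> bases M" "C \<in> bases N" for B C
  proof -
    have "B \<inter> C = {}"
      using that M.bases_iff N.bases_iff M.indep_subset_ground N.indep_subset_ground disjoint by blast
    then have "indicator B + indicator C = (indicator (B \<union> C) :: 'a \<Rightarrow> real)"
      by (auto simp: fun_eq_iff indicator_def)
    then show ?thesis using Un_bases_mem_indep_spanning_sets(1)[OF that] by simp
  qed
  then have "(\<lambda>B. indicator B) ` bases M + (\<lambda>B. indicator B) ` bases N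
      \<subseteq> (indicator ` indep_spanning_sets M N :: ('a \<Rightarrow> real) set)"
    by (auto simp: set_plus_def)
  ultimately show ?thesis using hull_mono by blast
qed

lemma remove_ground_left:
  assumes "X \<in> indep_spanning_sets M N" "e \<in> ground M"
  shows "X - {e} \<in> indep_spanning_sets M N"
proof -
  have "(X - {e}) \<inter> ground N = X \<inter> ground N" using assms disjoint by auto
  moreover have "(X - {e}) \<inter> ground M \<in> indep M"
    using assms by (auto simp: indep_spanning_sets_def elim!: M.indep_mono)
  ultimately show ?thesis using assms by (auto simp: indep_spanning_sets_def)
qed

lemma insert_ground_right:
  assumes "X \<in> indep_spanning_sets M N" "e \<in> ground N"
  shows "insert e X \<in> indep_spanning_sets M N"
proof -
  have "insert e X \<inter> ground M = X \<inter> ground M" using assms disjoint by auto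
  moreover have "rank_of N (insert e X \<inter> ground N) = rank N"
  proof (rule antisym)
    show "rank_of N (insert e X \<inter> ground N) \<le> rank N"
      unfolding rank_def by (intro N.rank_of_mono) auto
    have "rank N = rank_of N (X \<inter> ground N)" using assms by (simp add: indep_spanning_sets_def)
    also have "\<dots> \<le> rank_of N (insert e X \<inter> ground N)" by (intro N.rank_of_mono) auto
    finally show "rank N \<le> rank_of N (insert e X \<inter> ground N)" .
  qed
  ultimately show ?thesis using assms by (auto simp: indep_spanning_sets_def)
qed

text \<open>
  Vertices of the left-hand side satisfy the right-hand side, which is convex.  Conversely, let \<open>w\<close> and
  \<open>z\<close> witness \<open>below_base M x\<close> and \<open>above_base N x\<close>.  Lowering coordinates of \<open>w + z\<close> towards \<open>0\<close> on the
  ground set of \<open>M\<close> and raising them towards \<open>1\<close> on that of \<open>N\<close> reaches \<open>x\<close> within the convex hull of all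
  \<open>I \<union> S\<close>, and the slice lemma restricts the sets to those of cardinality \<open>rank M + rank N\<close>.
\<close>

theorem base_polytope_free_product:
  "x \<in> base_polytope (M \<box> N) \<longleftrightarrow>
    below_base M x \<and> above_base N x \<and> (\<forall>e. e \<notin> ground M \<union> ground N \<longrightarrow> x e = 0) \<and>
    (\<Sum>e\<in>ground M \<union> ground N. x e) = real (rank M + rank N)" (is "_ \<longleftrightarrow> ?R x")
proof
  interpret P: matroid "M \<box> N"
    using matroid_free_product M.matroid_axioms N.matroid_axioms disjoint .
  have ground: "ground (M \<box> N) = ground M \<union> ground N" by (simp add: free_product_def)
  obtain B where "B \<in> bases (M \<box> N)" using P.base_above_indep[OF P.indep_empty] by blast
  then have rank: "rank (M \<box> N) = rank M + rank N"
    using P.bases_iff[of B] bases_free_product by auto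
  assume x: "x \<in> base_polytope (M \<box> N)"
  have below: "below_base M (indicator B)" if B: "B \<in> bases (M \<box> N)" for B
  proof -
    have "B \<inter> ground M \<in> indep M"
      using B by (simp add: bases_free_product indep_spanning_sets_def)
    then obtain C where C: "C \<in> bases M" "B \<inter> ground M \<subseteq> C"
      using M.base_above_indep by blast
    then have "indicator C \<in> base_polytope M" unfolding base_polytope_def by (auto intro: hull_inc)
    then show ?thesis
      unfolding below_base_def using C(2)
      by (intro bexI[of _ "indicator C"]) (auto simp: indicator_def)
  qed
  have above: "above_base N (indicator B)" if B: "B \<in> bases (M \<box> N)" for B
  proof -
    obtain C where C: "C \<in> bases N" "C \<subseteq> B \<inter> ground N"
      using B N.rank_of_eq_rank_iff[of "B \<inter> ground N"]
      by (auto simp: bases_free_product indep_spanning_sets_def)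
    then have "indicator C \<in> base_polytope N" unfolding base_polytope_def by (auto intro: hull_inc)
    then show ?thesis
      unfolding above_base_def using C(2)
      by (intro bexI[of _ "indicator C"]) (auto simp: indicator_def)
  qed
  have "base_polytope (M \<box> N) \<subseteq> {x. below_base M x} \<inter> {x. above_base N x}"
    unfolding base_polytope_def using below above
    by (intro hull_minimal convex_Int convex_below_base convex_above_base) auto
  then show "?R x"
    using x P.base_polytope_coordinates(3,4)[OF x] by (auto simp: ground rank)
next
  assume R: "?R x"
  then obtain w z where w: "w \<in> base_polytope M" "\<And>e. e \<in> ground M \<Longrightarrow> 0 \<le> x e \<and> x e \<le> w e"
    and z: "z \<in> base_polytope N" "\<And>e. e \<in> ground N \<Longrightarrow> z e \<le> x e \<and> x e \<le> 1"
    by (auto simp: below_base_def above_base_def)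
  let ?F = "indep_spanning_sets M N" and ?A = "ground M \<union> ground N"
  note wc = M.base_polytope_coordinates[OF w(1)] and zc = N.base_polytope_coordinates[OF z(1)]
  have fin: "finite ?A" using M.finite_ground N.finite_ground by simp
  have "x \<in> convex hull (indicator ` ?F)"
  proof (rule moved_coordinates_mem_convex_hull[OF fin _ Un_base_polytopes[OF w(1) z(1)]])
    show "v(e := of_bool (e \<in> ground N)) \<in> indicator ` ?F" if e: "e \<in> ?A" and v: "v \<in> indicator ` ?F"
      for v :: "'a \<Rightarrow> real" and e
    proof -
      obtain X where X: "v = indicator X" "X \<in> ?F" using v by blast
      show ?thesis
      proof (cases "e \<in> ground N")
        case True
        have "v(e := 1) = indicator (insert e X)" by (auto simp: X fun_eq_iff indicator_def)
        then show ?thesis using True insert_ground_right[OF X(2) True] by simp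
      next
        case False
        have "v(e := 0) = indicator (X - {e})" by (auto simp: X fun_eq_iff indicator_def)
        then show ?thesis using False e remove_ground_left[OF X(2)] by simp
      qed
    qed
    fix e
    show "min ((w + z) e) (of_bool (e \<in> ground N)) \<le> x e \<and>
        x e \<le> max ((w + z) e) (of_bool (e \<in> ground N))" if "e \<in> ?A"
    proof (cases "e \<in> ground N")
      case True
      then have "e \<notin> ground M" using disjoint by blast
      then show ?thesis using True z(2)[of e] wc(3)[of e] by auto
    next
      case False
      then show ?thesis using that w(2)[of e] zc(3)[of e] by auto
    qed
    show "x e = (w + z) e" if "e \<notin> ?A" using that R wc(3)[of e] zc(3)[of e] by simp
  qed
  then show "x \<in> base_polytope (M \<box> N)"
    unfolding base_polytope_def bases_free_product
    using R indep_spanning_sets_exchange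
    by (intro convex_hull_indicators_slice[OF fin]) (auto simp: indep_spanning_sets_def)
qed

end

section \<open>Linear relations between base polytopes\<close>

lemma permuted_vimage_eq_image:
  "\<sigma> permutes A \<Longrightarrow> {w. w \<circ> \<sigma> \<in> K} = (\<lambda>w. w \<circ> inv \<sigma>) ` K"
proof (intro set_eqI iffI)
  fix w assume "\<sigma> permutes A" "w \<in> {w. w \<circ> \<sigma> \<in> K}"
  then show "w \<in> (\<lambda>w. w \<circ> inv \<sigma>) ` K"
    by (intro image_eqI[of _ _ "w \<circ> \<sigma>"]) (simp_all add: o_assoc[symmetric] permutes_inv_o)
qed (auto simp: o_assoc[symmetric] permutes_inv_o)

context matroid
begin

lemma permuted_base_polytope:
  assumes "\<sigma> permutes ground M"
  defines "K \<equiv> {w. w \<circ> \<sigma> \<in> base_polytope M}"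
  shows "compact K" "convex K" "w \<in> K \<Longrightarrow> e \<notin> ground M \<Longrightarrow> w e = 0"
proof -
  have K: "K = (\<lambda>w. w \<circ> inv \<sigma>) ` base_polytope M"
    unfolding K_def by (rule permuted_vimage_eq_image[OF assms(1)])
  have "continuous_on (base_polytope M) (\<lambda>w. w \<circ> inv \<sigma>)"
    unfolding o_def
    by (intro continuous_on_coordinatewise_then_product
        continuous_on_subset[OF continuous_on_product_coordinates subset_UNIV])
  then show "compact K" unfolding K by (rule compact_continuous_image[OF _ compact_base_polytope])
  have "linear (\<lambda>w :: 'a \<Rightarrow> real. w \<circ> inv \<sigma>)"
    by (intro linearI) (auto simp: fun_eq_iff scaleR_fun_def)
  then show "convex K"
    unfolding K base_polytope_def by (intro convex_linear_image convex_convex_hull)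
  show "w e = 0" if "w \<in> K" "e \<notin> ground M"
    using that base_polytope_coordinates(3)[of "w \<circ> \<sigma>" e] permutes_not_in[OF assms(1) that(2)]
    by (simp add: K_def)
qed

text \<open>
  Membership in the independent set polytope as a meeting of a compact convex set with an orthant that
  depends only on \<open>x\<close>; for all permutations \<open>\<sigma>\<close> the orthant is the same.
\<close>

lemma below_base_permuted_iff:
  assumes "\<sigma> permutes ground M"
  shows "below_base M (x \<circ> \<sigma>) \<longleftrightarrow> (\<forall>e\<in>ground M. 0 \<le> x e) \<and>
    {w. w \<circ> \<sigma> \<in> base_polytope M} \<inter> {w. \<forall>e\<in>ground M. x e \<le> w e} \<noteq> {}" (is "?l \<longleftrightarrow> ?r")
proof -
  have all: "(\<forall>e\<in>ground M. P (\<sigma> e)) \<longleftrightarrow> (\<forall>e\<in>ground M. P e)" for P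
    using permutes_image[OF assms] by (metis image_iff)
  have "?l \<longleftrightarrow> (\<exists>w. w \<circ> \<sigma> \<in> base_polytope M \<and>
      (\<forall>e\<in>ground M. 0 \<le> x (\<sigma> e) \<and> x (\<sigma> e) \<le> w (\<sigma> e)))"
  proof
    assume ?l
    then obtain v where v: "v \<in> base_polytope M"
        "\<forall>e\<in>ground M. 0 \<le> x (\<sigma> e) \<and> x (\<sigma> e) \<le> v e"
      by (auto simp: below_base_def)
    have "v = (v \<circ> inv \<sigma>) \<circ> \<sigma>" by (simp add: o_assoc[symmetric] permutes_inv_o[OF assms])
    with v show "\<exists>w. w \<circ> \<sigma> \<in> base_polytope M \<and>
        (\<forall>e\<in>ground M. 0 \<le> x (\<sigma> e) \<and> x (\<sigma> e) \<le> w (\<sigma> e))"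
      by (intro exI[of _ "v \<circ> inv \<sigma>"]) (simp add: permutes_inverses[OF assms])
  next
    assume "\<exists>w. w \<circ> \<sigma> \<in> base_polytope M \<and>
        (\<forall>e\<in>ground M. 0 \<le> x (\<sigma> e) \<and> x (\<sigma> e) \<le> w (\<sigma> e))"
    then obtain w where "w \<circ> \<sigma> \<in> base_polytope M"
        "\<forall>e\<in>ground M. 0 \<le> x (\<sigma> e) \<and> x (\<sigma> e) \<le> w (\<sigma> e)"
      by blast
    then show ?l unfolding below_base_def by (intro bexI[of _ "w \<circ> \<sigma>"]) auto
  qed
  then show ?thesis unfolding all[of "\<lambda>e. 0 \<le> x e \<and> x e \<le> w e" for w] by auto
qed

lemma above_base_permuted_iff:
  assumes "\<sigma> permutes ground M"
  shows "above_base M (x \<circ> \<sigma>) \<longleftrightarrow> (\<forall>e\<in>ground M. x e \<le> 1) \<and>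
    {w. w \<circ> \<sigma> \<in> base_polytope M} \<inter> {w. \<forall>e\<in>ground M. w e \<le> x e} \<noteq> {}" (is "?l \<longleftrightarrow> ?r")
proof -
  have all: "(\<forall>e\<in>ground M. P (\<sigma> e)) \<longleftrightarrow> (\<forall>e\<in>ground M. P e)" for P
    using permutes_image[OF assms] by (metis image_iff)
  have "?l \<longleftrightarrow> (\<exists>w. w \<circ> \<sigma> \<in> base_polytope M \<and>
      (\<forall>e\<in>ground M. w (\<sigma> e) \<le> x (\<sigma> e) \<and> x (\<sigma> e) \<le> 1))"
  proof
    assume ?l
    then obtain v where v: "v \<in> base_polytope M"
        "\<forall>e\<in>ground M. v e \<le> x (\<sigma> e) \<and> x (\<sigma> e) \<le> 1"
      by (auto simp: above_base_def)
    have "v = (v \<circ> inv \<sigma>) \<circ> \<sigma>" by (simp add: o_assoc[symmetric] permutes_inv_o[OF assms])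
    with v show "\<exists>w. w \<circ> \<sigma> \<in> base_polytope M \<and>
        (\<forall>e\<in>ground M. w (\<sigma> e) \<le> x (\<sigma> e) \<and> x (\<sigma> e) \<le> 1)"
      by (intro exI[of _ "v \<circ> inv \<sigma>"]) (simp add: permutes_inverses[OF assms])
  next
    assume "\<exists>w. w \<circ> \<sigma> \<in> base_polytope M \<and>
        (\<forall>e\<in>ground M. w (\<sigma> e) \<le> x (\<sigma> e) \<and> x (\<sigma> e) \<le> 1)"
    then obtain w where "w \<circ> \<sigma> \<in> base_polytope M"
        "\<forall>e\<in>ground M. w (\<sigma> e) \<le> x (\<sigma> e) \<and> x (\<sigma> e) \<le> 1"
      by blast
    then show ?l unfolding above_base_def by (intro bexI[of _ "w \<circ> \<sigma>"]) auto
  qed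
  then show ?thesis unfolding all[of "\<lambda>e. w e \<le> x e \<and> x e \<le> 1" for w] by auto
qed

end

text \<open>
  Intersecting with \<open>C\<close> multiplies all indicator functions by that of \<open>C\<close>, so the relation survives,
  and the Euler characteristic turns it into a relation between the numbers
  \<open>[K \<inter> C \<noteq> {}]\<close>.  A general set \<open>G\<close> of permutations covers plain indicator functions (\<open>G = {id}\<close>) and
  symmetrized ones (all permutations of the ground set).
\<close>

lemma permuted_base_polytopes_meet_relation:
  fixes N :: "'i \<Rightarrow> 'a set_system" and a :: "'i \<Rightarrow> real"
  assumes A: "finite A" and G: "finite G" "\<And>\<sigma>. \<sigma> \<in> G \<Longrightarrow> \<sigma> permutes A" and I: "finite I"
    and M: "matroid M" "ground M = A"
    and N: "\<And>i. i \<in> I \<Longrightarrow> matroid (N i)" "\<And>i. i \<in> I \<Longrightarrow> ground (N i) = A"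
    and C: "closed C" "convex C"
    and rel: "\<And>x. (\<Sum>\<sigma>\<in>G. base_indicator M (x \<circ> \<sigma>)) =
      (\<Sum>i\<in>I. a i * (\<Sum>\<sigma>\<in>G. base_indicator (N i) (x \<circ> \<sigma>)))"
  shows "(\<Sum>\<sigma>\<in>G. of_bool ({w. w \<circ> \<sigma> \<in> base_polytope M} \<inter> C \<noteq> {})) =
    (\<Sum>i\<in>I. a i * (\<Sum>\<sigma>\<in>G. of_bool ({w. w \<circ> \<sigma> \<in> base_polytope (N i)} \<inter> C \<noteq> {})))"
proof -
  \<comment> \<open>Both sides of the relation become one family; the index \<open>None\<close> stands for \<open>M\<close>.\<close>
  define L where "L = case_option M N"
  define c where "c = case_option (-1) a"
  define J where "J = insert None (Some ` I)"
  have L: "matroid (L o')" "ground (L o') = A" if "o' \<in> J" for o'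
    using that M N by (auto simp: L_def J_def)
  let ?K = "\<lambda>(o', \<sigma>). {w. w \<circ> \<sigma> \<in> base_polytope (L o')} \<inter> C"
  have expand: "(\<Sum>(o', \<sigma>)\<in>J \<times> G. c o' * f (L o') \<sigma>) =
      (\<Sum>i\<in>I. a i * (\<Sum>\<sigma>\<in>G. f (N i) \<sigma>)) - (\<Sum>\<sigma>\<in>G. f M \<sigma>)"
    for f :: "'a set_system \<Rightarrow> ('a \<Rightarrow> 'a) \<Rightarrow> real"
  proof -
    have "(\<Sum>(o', \<sigma>)\<in>J \<times> G. c o' * f (L o') \<sigma>) = (\<Sum>o'\<in>J. c o' * (\<Sum>\<sigma>\<in>G. f (L o') \<sigma>))"
      unfolding sum.cartesian_product[symmetric] sum_distrib_left ..
    also have "\<dots> = (\<Sum>i\<in>I. a i * (\<Sum>\<sigma>\<in>G. f (N i) \<sigma>)) - (\<Sum>\<sigma>\<in>G. f M \<sigma>)"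
      using I by (simp add: J_def c_def L_def sum.reindex)
    finally show ?thesis .
  qed
  have "(\<Sum>j\<in>J \<times> G. c (fst j) * of_bool (?K j \<noteq> {})) = 0"
  proof (rule indicator_relation_nonempty[OF A, where z = "\<lambda>_. 0"])
    show "finite (J \<times> G)" using I G by (simp add: J_def)
    fix j assume j: "j \<in> J \<times> G"
    obtain o' \<sigma> where j_eq: "j = (o', \<sigma>)" "o' \<in> J" "\<sigma> \<in> G" using j by auto
    interpret L: matroid "L o'" using L(1)[OF j_eq(2)] .
    have perm: "\<sigma> permutes ground (L o')" using G(2) L(2) j_eq by simp
    note K = L.permuted_base_polytope[OF perm]
    show "compact (?K j)" using K(1) C(1) by (simp add: j_eq compact_Int_closed)
    show "convex (?K j)" using K(2) C(2) by (simp add: j_eq convex_Int)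
    show "x e = 0" if "x \<in> ?K j" "e \<notin> A" for x e
      using that K(3)[of x e] L(2)[OF j_eq(2)] by (simp add: j_eq)
  next
    fix x
    have "(\<Sum>j\<in>J \<times> G. c (fst j) * indicator (?K j) x) =
        indicator C x * (\<Sum>(o', \<sigma>)\<in>J \<times> G. c o' * base_indicator (L o') (x \<circ> \<sigma>))"
      unfolding sum_distrib_left
      by (intro sum.cong) (auto simp: base_indicator_def indicator_def)
    also have "\<dots> = 0"
      unfolding expand[of "\<lambda>N \<sigma>. base_indicator N (x \<circ> \<sigma>)"] using rel[of x] by simp
    finally show "(\<Sum>j\<in>J \<times> G. c (fst j) * indicator (?K j) x) = 0" .
  qed
  then have "(\<Sum>(o', \<sigma>)\<in>J \<times> G.
      c o' * of_bool ({w. w \<circ> \<sigma> \<in> base_polytope (L o')} \<inter> C \<noteq> {})) = (0 :: real)"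
    by (simp add: split_def)
  then show ?thesis
    using expand[of "\<lambda>N \<sigma>. of_bool ({w. w \<circ> \<sigma> \<in> base_polytope N} \<inter> C \<noteq> {})"] by simp
qed

text \<open>
  Up to the condition \<open>0 \<le> x\<close> or \<open>x \<le> 1\<close> on the ground set, which is common to all terms, both relations
  are instances of the preceding lemma, with \<open>C\<close> an orthant with corner \<open>x\<close>.
\<close>

lemma
  fixes N :: "'i \<Rightarrow> 'a set_system" and a :: "'i \<Rightarrow> real"
  assumes G: "finite G" "\<And>\<sigma>. \<sigma> \<in> G \<Longrightarrow> \<sigma> permutes A" and I: "finite I"
    and M: "matroid M" "ground M = A"
    and N: "\<And>i. i \<in> I \<Longrightarrow> matroid (N i)" "\<And>i. i \<in> I \<Longrightarrow> ground (N i) = A"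
    and rel: "\<And>x. (\<Sum>\<sigma>\<in>G. base_indicator M (x \<circ> \<sigma>)) =
      (\<Sum>i\<in>I. a i * (\<Sum>\<sigma>\<in>G. base_indicator (N i) (x \<circ> \<sigma>)))"
  shows below_base_relation: "(\<Sum>\<sigma>\<in>G. of_bool (below_base M (x \<circ> \<sigma>))) =
      (\<Sum>i\<in>I. a i * (\<Sum>\<sigma>\<in>G. of_bool (below_base (N i) (x \<circ> \<sigma>))))"
    and above_base_relation: "(\<Sum>\<sigma>\<in>G. of_bool (above_base M (x \<circ> \<sigma>))) =
      (\<Sum>i\<in>I. a i * (\<Sum>\<sigma>\<in>G. of_bool (above_base (N i) (x \<circ> \<sigma>))))"
proof -
  have A: "finite A" using matroid.finite_ground[OF M(1)] M(2) by simp
  note meet = permuted_base_polytopes_meet_relation[OF A G I M N _ _ rel]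
  let ?U = "{w :: 'a \<Rightarrow> real. \<forall>e\<in>A. x e \<le> w e}" and ?D = "{w :: 'a \<Rightarrow> real. \<forall>e\<in>A. w e \<le> x e}"
  have U: "?U = (\<Inter>e\<in>A. {w. x e \<le> w e})" and D: "?D = (\<Inter>e\<in>A. {w. w e \<le> x e})" by auto
  have "closed ?U" "convex ?U" "closed ?D" "convex ?D"
    unfolding U D
    by (intro closed_INT convex_INT ballI closed_Collect_le continuous_on_const
        continuous_on_product_coordinates convex_coordinate_le convex_coordinate_ge)+
  then have
    up: "(\<Sum>\<sigma>\<in>G. of_bool ({w. w \<circ> \<sigma> \<in> base_polytope M} \<inter> ?U \<noteq> {})) =
      (\<Sum>i\<in>I. a i * (\<Sum>\<sigma>\<in>G. of_bool ({w. w \<circ> \<sigma> \<in> base_polytope (N i)} \<inter> ?U \<noteq> {})))"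
    and down: "(\<Sum>\<sigma>\<in>G. of_bool ({w. w \<circ> \<sigma> \<in> base_polytope M} \<inter> ?D \<noteq> {})) =
      (\<Sum>i\<in>I. a i * (\<Sum>\<sigma>\<in>G. of_bool ({w. w \<circ> \<sigma> \<in> base_polytope (N i)} \<inter> ?D \<noteq> {})))"
    by (auto intro!: meet)
  have below: "(\<Sum>\<sigma>\<in>G. of_bool (below_base L (x \<circ> \<sigma>))) = of_bool (\<forall>e\<in>A. 0 \<le> x e) *
      (\<Sum>\<sigma>\<in>G. of_bool ({w. w \<circ> \<sigma> \<in> base_polytope L} \<inter> ?U \<noteq> {}) :: real)"
    if "matroid L" "ground L = A" for L
    unfolding sum_distrib_left of_bool_conj[symmetric]
    using matroid.below_base_permuted_iff[OF that(1), unfolded that(2), OF G(2)]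
    by (intro sum.cong refl) simp
  have above: "(\<Sum>\<sigma>\<in>G. of_bool (above_base L (x \<circ> \<sigma>))) = of_bool (\<forall>e\<in>A. x e \<le> 1) *
      (\<Sum>\<sigma>\<in>G. of_bool ({w. w \<circ> \<sigma> \<in> base_polytope L} \<inter> ?D \<noteq> {}) :: real)"
    if "matroid L" "ground L = A" for L
    unfolding sum_distrib_left of_bool_conj[symmetric]
    using matroid.above_base_permuted_iff[OF that(1), unfolded that(2), OF G(2)]
    by (intro sum.cong refl) simp
  show "(\<Sum>\<sigma>\<in>G. of_bool (below_base M (x \<circ> \<sigma>))) =
      (\<Sum>i\<in>I. a i * (\<Sum>\<sigma>\<in>G. of_bool (below_base (N i) (x \<circ> \<sigma>))))"
    unfolding below[OF M] up sum_distrib_left[of "of_bool _" _ I]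
    by (intro sum.cong refl) (simp add: below[OF N])
  show "(\<Sum>\<sigma>\<in>G. of_bool (above_base M (x \<circ> \<sigma>))) =
      (\<Sum>i\<in>I. a i * (\<Sum>\<sigma>\<in>G. of_bool (above_base (N i) (x \<circ> \<sigma>))))"
    unfolding above[OF M] down sum_distrib_left[of "of_bool _" _ I]
    by (intro sum.cong refl) (simp add: above[OF N])
qed

section \<open>Symmetrization\<close>

text \<open>
  The symmetrized function without its factor \<open>1 / n!\<close>, for an arbitrary finite set of coordinates.
\<close>

definition perm_sum :: "'a set \<Rightarrow> (('a \<Rightarrow> real) \<Rightarrow> real) \<Rightarrow> ('a \<Rightarrow> real) \<Rightarrow> real" where
  "perm_sum A f x = (\<Sum>\<sigma> | \<sigma> permutes A. f (x \<circ> \<sigma>))"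

definition on_slice :: "'a set \<Rightarrow> nat \<Rightarrow> ('a \<Rightarrow> real) \<Rightarrow> bool" where
  "on_slice A r x \<longleftrightarrow> (\<forall>e. e \<notin> A \<longrightarrow> x e = 0) \<and> (\<Sum>e\<in>A. x e) = real r"

lemma on_slice_permuted:
  assumes "\<sigma> permutes A" "on_slice A r x"
  shows "on_slice A r (x \<circ> \<sigma>)"
  using assms sum.permute[OF assms(1), of x] permutes_not_in[OF assms(1)]
  by (auto simp: on_slice_def)

lemma on_slice_permuted_iff:
  assumes "\<sigma> permutes A"
  shows "on_slice A r (x \<circ> \<sigma>) \<longleftrightarrow> on_slice A r x"
proof
  show "on_slice A r x" if "on_slice A r (x \<circ> \<sigma>)"
    using on_slice_permuted[OF permutes_inv[OF assms] that]
    by (simp add: o_assoc[symmetric] permutes_inv_o[OF assms])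
qed (rule on_slice_permuted[OF assms])

lemma below_base_cong: "(\<And>e. e \<in> ground M \<Longrightarrow> x e = y e) \<Longrightarrow> below_base M x \<longleftrightarrow> below_base M y"
  by (simp add: below_base_def)

lemma above_base_cong: "(\<And>e. e \<in> ground M \<Longrightarrow> x e = y e) \<Longrightarrow> above_base M x \<longleftrightarrow> above_base M y"
  by (simp add: above_base_def)

context disjoint_matroids
begin

lemma base_indicator_free_product:
  "base_indicator (M \<box> N) x = of_bool (below_base M x) * of_bool (above_base N x) *
    of_bool (on_slice (ground M \<union> ground N) (rank M + rank N) x)"
  unfolding base_indicator_def indicator_def base_polytope_free_product on_slice_def by simp

text \<open>
  For permutations \<open>\<tau>\<close> and \<open>\<tau>'\<close> of the two ground sets, the sum over \<open>\<rho>\<close> is unchanged when \<open>\<rho>\<close> is replaced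
  by \<open>\<rho> \<circ> \<tau> \<circ> \<tau>'\<close>.  Of the three factors of the indicator function, the one for \<open>M\<close> sees only \<open>\<tau>\<close>, the one
  for \<open>N\<close> sees only \<open>\<tau>'\<close>, and the slice condition sees neither.
\<close>

lemma perm_sum_free_product:
  "fact (card (ground M)) * fact (card (ground N)) *
      perm_sum (ground M \<union> ground N) (base_indicator (M \<box> N)) x =
    (\<Sum>\<rho> | \<rho> permutes ground M \<union> ground N.
      perm_sum (ground M) (\<lambda>y. of_bool (below_base M y)) (x \<circ> \<rho>) *
      perm_sum (ground N) (\<lambda>y. of_bool (above_base N y)) (x \<circ> \<rho>) *
      of_bool (on_slice (ground M \<union> ground N) (rank M + rank N) (x \<circ> \<rho>)))" (is "_ = ?r")
proof -
  let ?A = "ground M" and ?B = "ground N" and ?r = "rank M + rank N"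
  let ?P = "{\<rho>. \<rho> permutes ?A \<union> ?B}"
  have split: "base_indicator (M \<box> N) (y \<circ> (\<tau> \<circ> \<tau>')) =
      of_bool (below_base M (y \<circ> \<tau>)) * of_bool (above_base N (y \<circ> \<tau>')) *
      of_bool (on_slice (?A \<union> ?B) ?r y)"
    if \<tau>: "\<tau> permutes ?A" "\<tau>' permutes ?B" for y \<tau> \<tau>'
  proof -
    have "\<tau> \<circ> \<tau>' permutes ?A \<union> ?B"
      using \<tau> by (intro permutes_compose) (auto intro: permutes_subset)
    moreover have "below_base M (y \<circ> (\<tau> \<circ> \<tau>')) \<longleftrightarrow> below_base M (y \<circ> \<tau>)"
    proof (rule below_base_cong)
      fix e assume "e \<in> ?A"
      then have "\<tau>' e = e" using permutes_not_in[OF \<tau>(2)] disjoint by blast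
      then show "(y \<circ> (\<tau> \<circ> \<tau>')) e = (y \<circ> \<tau>) e" by simp
    qed
    moreover have "above_base N (y \<circ> (\<tau> \<circ> \<tau>')) \<longleftrightarrow> above_base N (y \<circ> \<tau>')"
    proof (rule above_base_cong)
      fix e assume "e \<in> ?B"
      then have "\<tau>' e \<in> ?B" using permutes_in_image[OF \<tau>(2)] by blast
      then have "\<tau> (\<tau>' e) = \<tau>' e" using permutes_not_in[OF \<tau>(1)] disjoint by blast
      then show "(y \<circ> (\<tau> \<circ> \<tau>')) e = (y \<circ> \<tau>') e" by simp
    qed
    ultimately show ?thesis
      unfolding base_indicator_free_product by (simp add: on_slice_permuted_iff)
  qed
  have "fact (card ?A) * fact (card ?B) * perm_sum (?A \<union> ?B) (base_indicator (M \<box> N)) x =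
      (\<Sum>\<tau> | \<tau> permutes ?A. \<Sum>\<tau>' | \<tau>' permutes ?B.
        perm_sum (?A \<union> ?B) (base_indicator (M \<box> N)) x)"
    by (simp add: card_permutations[OF refl M.finite_ground]
        card_permutations[OF refl N.finite_ground])
  also have "\<dots> = (\<Sum>\<tau> | \<tau> permutes ?A. \<Sum>\<tau>' | \<tau>' permutes ?B. \<Sum>\<rho>\<in>?P.
      of_bool (below_base M (x \<circ> \<rho> \<circ> \<tau>)) * of_bool (above_base N (x \<circ> \<rho> \<circ> \<tau>')) *
      of_bool (on_slice (?A \<union> ?B) ?r (x \<circ> \<rho>)))"
  proof (intro sum.cong refl)
    fix \<tau> \<tau>' assume "\<tau> \<in> {\<tau>. \<tau> permutes ?A}" "\<tau>' \<in> {\<tau>'. \<tau>' permutes ?B}"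
    then have \<tau>: "\<tau> permutes ?A" "\<tau>' permutes ?B" by auto
    then have "\<tau> \<circ> \<tau>' permutes ?A \<union> ?B"
      by (intro permutes_compose) (auto intro: permutes_subset)
    then have "perm_sum (?A \<union> ?B) (base_indicator (M \<box> N)) x =
        (\<Sum>\<rho>\<in>?P. base_indicator (M \<box> N) (x \<circ> (\<rho> \<circ> (\<tau> \<circ> \<tau>'))))"
      unfolding perm_sum_def by (rule sum_permutations_compose_right)
    also have "\<dots> = (\<Sum>\<rho>\<in>?P. base_indicator (M \<box> N) ((x \<circ> \<rho>) \<circ> (\<tau> \<circ> \<tau>')))"
      by (simp add: o_assoc)
    finally show "perm_sum (?A \<union> ?B) (base_indicator (M \<box> N)) x = (\<Sum>\<rho>\<in>?P.
        of_bool (below_base M (x \<circ> \<rho> \<circ> \<tau>)) * of_bool (above_base N (x \<circ> \<rho> \<circ> \<tau>')) *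
        of_bool (on_slice (?A \<union> ?B) ?r (x \<circ> \<rho>)))"
      unfolding split[OF \<tau>] .
  qed
  also have "\<dots> = (\<Sum>\<rho>\<in>?P. \<Sum>\<tau> | \<tau> permutes ?A. \<Sum>\<tau>' | \<tau>' permutes ?B.
      of_bool (below_base M (x \<circ> \<rho> \<circ> \<tau>)) * of_bool (above_base N (x \<circ> \<rho> \<circ> \<tau>')) *
      of_bool (on_slice (?A \<union> ?B) ?r (x \<circ> \<rho>)))"
    unfolding sum.swap[of _ ?P "{\<tau>'. \<tau>' permutes ?B}"] by (rule sum.swap)
  also have "\<dots> = (\<Sum>\<rho>\<in>?P. perm_sum ?A (\<lambda>y. of_bool (below_base M y)) (x \<circ> \<rho>) *
      perm_sum ?B (\<lambda>y. of_bool (above_base N y)) (x \<circ> \<rho>) *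
      of_bool (on_slice (?A \<union> ?B) ?r (x \<circ> \<rho>)))"
    unfolding perm_sum_def sum_product unfolding sum_distrib_right ..
  finally show ?thesis .
qed

end

lemma bases_image:
  assumes "inj f" "indep N = (\<lambda>X. f ` X) ` indep M"
  shows "bases N = (\<lambda>X. f ` X) ` bases M"
proof -
  have "f ` X \<in> bases N \<longleftrightarrow> X \<in> bases M" for X
    unfolding bases_def assms(2) using assms(1)
    by (simp add: inj_image_eq_iff inj_image_subset_iff inj_image_mem_iff inj_on_image)
  moreover have "bases N \<subseteq> (\<lambda>X. f ` X) ` indep M" by (auto simp: bases_def assms(2))
  moreover have "bases M \<subseteq> indep M" by (auto simp: bases_def)
  ultimately show ?thesis by blast
qed

lemma mem_base_polytope_image_iff:
  fixes f :: "'a \<Rightarrow> 'b"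
  assumes f: "bij f" and N: "indep N = (\<lambda>X. f ` X) ` indep M"
  shows "x \<in> base_polytope N \<longleftrightarrow> x \<circ> f \<in> base_polytope M"
proof -
  define T where "T = (\<lambda>x :: 'b \<Rightarrow> real. x \<circ> f)"
  have lin: "linear T"
    by (intro linearI) (auto simp: T_def fun_eq_iff scaleR_fun_def)
  have inj: "inj f" using f by (simp add: bij_def)
  have "T (indicator (f ` B)) = indicator B" for B
    using inj by (auto simp: T_def fun_eq_iff indicator_def inj_image_mem_iff)
  then have "T ` base_polytope N = base_polytope M"
    unfolding base_polytope_def convex_hull_linear_image[OF lin] bases_image[OF inj N]
    by (simp add: image_image)
  moreover have "inj T"
  proof (rule injI)
    fix x y assume "T x = T y"
    then have "x (f i) = y (f i)" for i by (simp add: T_def fun_eq_iff)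
    then show "x = y" using f by (metis bij_pointE ext)
  qed
  ultimately show ?thesis using inj_image_mem_iff[of T x "base_polytope N"] by (simp add: T_def)
qed

lemma permutes_conjugate:
  assumes p: "bij p" and t: "t permutes A"
  shows "p \<circ> t \<circ> inv p permutes p ` A"
  unfolding permutes_def
proof (intro conjI allI impI)
  fix x assume "x \<notin> p ` A"
  then have "inv p x \<notin> A" using p by (metis bij_inv_eq_iff image_eqI)
  then show "(p \<circ> t \<circ> inv p) x = x"
    using permutes_not_in[OF t] p by (simp add: bij_is_surj surj_f_inv_f)
next
  fix y
  have "bij (p \<circ> t \<circ> inv p)" using p t by (intro bij_comp permutes_bij[of t A] bij_imp_bij_inv)
  then show "\<exists>!x. (p \<circ> t \<circ> inv p) x = y" by (metis bij_iff)
qed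

text \<open>
  The symmetrized indicator function numbers its coordinates from \<open>0\<close>.  The renaming \<open>p\<close> translates to
  an arbitrary ground set of natural numbers, as is needed to place two matroids on disjoint ground
  sets.
\<close>

lemma sym_base_indicator_eq_perm_sum:
  fixes N :: "nat set_system"
  assumes N: "matroid N" and p: "bij p" "p ` {..<card (ground N)} = ground N"
  shows "sym_base_indicator N (z \<circ> p) =
    perm_sum (ground N) (base_indicator N) z / fact (card (ground N))"
proof -
  let ?m = "card (ground N)"
  define q where "q = inv p"
  have q: "bij q" "q \<circ> p = id" "p \<circ> q = id" "inv q = p"
    using p(1) unfolding q_def
    by (auto simp: bij_imp_bij_inv bij_is_inj bij_is_surj inv_inv_eq surj_iff[symmetric])
  define L where "L = \<lparr>ground = q ` ground N, indep = (\<lambda>X. q ` X) ` indep N\<rparr>"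
  have L: "matroid L" "isomorphic N L"
    using matroid_image[OF N, of q] q(1) by (auto simp: L_def bij_def inj_on_def)
  have q_ground: "q ` ground N = {..<?m}"
  proof -
    have "q ` ground N = q ` p ` {..<?m}" by (simp only: p(2))
    also have "\<dots> = {..<?m}" unfolding image_comp q(2) by simp
    finally show ?thesis .
  qed
  then have "ground L = {..<?m}" by (simp add: L_def)
  then have "sym_base_indicator N (z \<circ> p) = sym_indicator ?m (base_polytope L) (z \<circ> p)"
    using sym_base_indicator_eq[OF N L] by simp
  also have "\<dots> = (\<Sum>\<tau> | \<tau> permutes {..<?m}. indicator (base_polytope L) (z \<circ> p \<circ> \<tau>)) / fact ?m"
    by (simp add: sym_indicator_def o_def)
  also have "(\<Sum>\<tau> | \<tau> permutes {..<?m}. indicator (base_polytope L) (z \<circ> p \<circ> \<tau>)) =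
      perm_sum (ground N) (base_indicator N) z"
    unfolding perm_sum_def
  proof (rule sum.reindex_bij_witness[where i = "\<lambda>\<sigma>. q \<circ> \<sigma> \<circ> p" and j = "\<lambda>\<tau>. p \<circ> \<tau> \<circ> q"])
    have L_iff: "x \<in> base_polytope L \<longleftrightarrow> x \<circ> q \<in> base_polytope N" for x
      by (rule mem_base_polytope_image_iff[OF q(1)]) (simp add: L_def)
    have pq: "p (q i) = i" "q (p i) = i" for i using q(2,3) by (metis comp_apply id_apply)+
    fix \<tau> assume "\<tau> \<in> {\<tau>. \<tau> permutes {..<?m}}"
    then show "p \<circ> \<tau> \<circ> q \<in> {\<sigma>. \<sigma> permutes ground N}"
      using permutes_conjugate[OF p(1), of \<tau> "{..<?m}"] p(2) by (simp add: q_def)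
    show "q \<circ> (p \<circ> \<tau> \<circ> q) \<circ> p = \<tau>" by (simp add: fun_eq_iff pq)
    show "base_indicator N (z \<circ> (p \<circ> \<tau> \<circ> q)) = indicator (base_polytope L) (z \<circ> p \<circ> \<tau>)"
      by (simp add: base_indicator_def indicator_def L_iff o_assoc)
  next
    have pq: "p (q i) = i" "q (p i) = i" for i using q(2,3) by (metis comp_apply id_apply)+
    fix \<sigma> assume "\<sigma> \<in> {\<sigma>. \<sigma> permutes ground N}"
    then show "q \<circ> \<sigma> \<circ> p \<in> {\<tau>. \<tau> permutes {..<?m}}"
      using permutes_conjugate[OF q(1), of \<sigma> "ground N"] q(4) q_ground by simp
    show "p \<circ> (q \<circ> \<sigma> \<circ> p) \<circ> q = \<sigma>" by (simp add: fun_eq_iff pq)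
  qed
  finally show ?thesis .
qed

lemma ex_isomorphic_on:
  assumes "matroid M" "finite A" "card A = card (ground M)"
  shows "\<exists>N. matroid N \<and> isomorphic M N \<and> ground N = A"
proof -
  obtain f where f: "bij_betw f (ground M) A"
    using finite_same_card_bij[OF matroid.finite_ground[OF assms(1)] assms(2)] assms(3) by auto
  then show ?thesis
    using matroid_image[OF assms(1), of f]
    by (intro exI[of _ "\<lparr>ground = f ` ground M, indep = (\<lambda>X. f ` X) ` indep M\<rparr>"])
      (auto simp: bij_betw_def)
qed

lemma isomorphic_rank:
  assumes "matroid M" "matroid N" "isomorphic M N"
  shows "rank N = rank M"
proof -
  obtain f where f: "bij_betw f (ground M) (ground N)"
      "\<forall>X\<subseteq>ground M. f ` X \<in> indep N \<longleftrightarrow> X \<in> indep M"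
    using assms(3) unfolding isomorphic_def by blast
  then show ?thesis
    using iso_rank_of[OF assms(1,2) f, of "ground M"] by (simp add: rank_def bij_betw_def)
qed

text \<open>
  Representatives on a prescribed ground set make representatives of classes for \<open>M\<close> and of
  classes for \<open>M'\<close> disjoint.
\<close>

lemma ex_representatives:
  assumes "finite A"
  obtains R where "\<And>X. X \<in> unlabeled_nested r (card A) \<Longrightarrow>
    matroid (R X) \<and> ground (R X) = A \<and> rank (R X) = r \<and> X = iso_rel `` {R X}"
proof -
  have "\<exists>N. matroid N \<and> ground N = A \<and> rank N = r \<and> X = iso_rel `` {N}"
    if X: "X \<in> unlabeled_nested r (card A)" for X
  proof -
    obtain L where L: "matroid L" "rank L = r" "card (ground L) = card A" "X = iso_rel `` {L}"
      using X by (auto simp: unlabeled_nested_def quotient_def)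
    obtain N where N: "matroid N" "isomorphic L N" "ground N = A"
      using ex_isomorphic_on[OF L(1) assms] L(3) by auto
    have "X = iso_rel `` {N}"
      using equiv_class_eq[OF equiv_iso_rel, of L N] L N by (simp add: iso_rel_def)
    then show ?thesis using N isomorphic_rank[OF L(1) N(1,2)] L(2) by blast
  qed
  then show ?thesis using that by metis
qed

section \<open>Free products and linear relations\<close>

lemma disjoint_matroidsI:
  "matroid M \<Longrightarrow> matroid N \<Longrightarrow> ground M \<inter> ground N = {} \<Longrightarrow> disjoint_matroids M N"
  by (simp add: disjoint_matroids_def disjoint_matroids_axioms_def)

theorem base_indicator_free_product_relation:
  fixes N :: "'i \<Rightarrow> 'a set_system" and N' :: "'j \<Rightarrow> 'a set_system"
    and a :: "'i \<Rightarrow> real" and b :: "'j \<Rightarrow> real"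
  assumes M: "matroid M" "matroid M'" "ground M \<inter> ground M' = {}"
    and I: "finite I" "\<And>i. i \<in> I \<Longrightarrow> matroid (N i) \<and> ground (N i) = ground M \<and> rank (N i) = rank M"
    and J: "finite J" "\<And>j. j \<in> J \<Longrightarrow> matroid (N' j) \<and> ground (N' j) = ground M' \<and> rank (N' j) = rank M'"
    and rel: "\<And>x. base_indicator M x = (\<Sum>i\<in>I. a i * base_indicator (N i) x)"
    and rel': "\<And>x. base_indicator M' x = (\<Sum>j\<in>J. b j * base_indicator (N' j) x)"
  shows "base_indicator (M \<box> M') x =
    (\<Sum>i\<in>I. \<Sum>j\<in>J. a i * b j * base_indicator (N i \<box> N' j) x)"
proof -
  note product = disjoint_matroids.base_indicator_free_product[OF disjoint_matroidsI]
  have below: "of_bool (below_base M x) = (\<Sum>i\<in>I. a i * of_bool (below_base (N i) x))"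
    using below_base_relation[of "{id}" "ground M" I M N a x] I M rel by (simp add: permutes_id)
  have above: "of_bool (above_base M' x) = (\<Sum>j\<in>J. b j * of_bool (above_base (N' j) x))"
    using above_base_relation[of "{id}" "ground M'" J M' N' b x] J M rel' by (simp add: permutes_id)
  let ?s = "of_bool (on_slice (ground M \<union> ground M') (rank M + rank M') x) :: real"
  have "base_indicator (M \<box> M') x = (\<Sum>i\<in>I. \<Sum>j\<in>J.
      (a i * of_bool (below_base (N i) x)) * (b j * of_bool (above_base (N' j) x)) * ?s)"
    unfolding product[OF M] below above sum_product unfolding sum_distrib_right ..
  also have "\<dots> = (\<Sum>i\<in>I. \<Sum>j\<in>J. a i * b j * base_indicator (N i \<box> N' j) x)"
  proof (intro sum.cong refl)
    fix i j assume "i \<in> I" "j \<in> J"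
    then have NN: "matroid (N i)" "matroid (N' j)" "ground (N i) \<inter> ground (N' j) = {}"
      "ground (N i) = ground M" "ground (N' j) = ground M'" "rank (N i) = rank M" "rank (N' j) = rank M'"
      using I J M by auto
    show "(a i * of_bool (below_base (N i) x)) * (b j * of_bool (above_base (N' j) x)) * ?s =
        a i * b j * base_indicator (N i \<box> N' j) x"
      unfolding product[OF NN(1-3)] NN(4-) by (simp only: mult.assoc mult.left_commute mult.commute)
  qed
  finally show ?thesis .
qed

text \<open>
  Both sides are multiplied by the number of pairs of permutations of the two ground sets; then
  \<open>perm_sum_free_product\<close> makes them sums over \<open>\<rho>\<close> of products of three factors, and the relations for
  \<open>below_base\<close> and \<open>above_base\<close> can be inserted for each \<open>\<rho>\<close>.
\<close>

theorem perm_sum_free_product_relation: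
  fixes N :: "'i \<Rightarrow> 'a set_system" and N' :: "'j \<Rightarrow> 'a set_system"
    and a :: "'i \<Rightarrow> real" and b :: "'j \<Rightarrow> real"
  assumes M: "matroid M" "matroid M'" "ground M \<inter> ground M' = {}"
    and I: "finite I" "\<And>i. i \<in> I \<Longrightarrow> matroid (N i) \<and> ground (N i) = ground M \<and> rank (N i) = rank M"
    and J: "finite J" "\<And>j. j \<in> J \<Longrightarrow> matroid (N' j) \<and> ground (N' j) = ground M' \<and> rank (N' j) = rank M'"
    and rel: "\<And>x. perm_sum (ground M) (base_indicator M) x =
      (\<Sum>i\<in>I. a i * perm_sum (ground M) (base_indicator (N i)) x)"
    and rel': "\<And>x. perm_sum (ground M') (base_indicator M') x =
      (\<Sum>j\<in>J. b j * perm_sum (ground M') (base_indicator (N' j)) x)"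
  shows "perm_sum (ground M \<union> ground M') (base_indicator (M \<box> M')) x =
    (\<Sum>i\<in>I. \<Sum>j\<in>J. a i * b j *
      perm_sum (ground M \<union> ground M') (base_indicator (N i \<box> N' j)) x)" (is "?l = ?r")
proof -
  let ?A = "ground M" and ?B = "ground M'"
  let ?P = "{\<rho>. \<rho> permutes ?A \<union> ?B}"
  let ?s = "\<lambda>y. of_bool (on_slice (?A \<union> ?B) (rank M + rank M') y) :: real"
  let ?c = "fact (card ?A) * fact (card ?B) :: real"
  define below where "below L = perm_sum ?A (\<lambda>y. of_bool (below_base L y))" for L
  define above where "above L = perm_sum ?B (\<lambda>y. of_bool (above_base L y))" for L
  have fin: "finite ?A" "finite ?B" using M matroid.finite_ground by auto
  note product = disjoint_matroids.perm_sum_free_product[OF disjoint_matroidsI]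
  have below: "below M y = (\<Sum>i\<in>I. a i * below (N i) y)" for y
    unfolding below_def perm_sum_def
    using I M rel finite_permutations[OF fin(1)]
    by (intro below_base_relation[where A = ?A]) (auto simp: perm_sum_def)
  have above: "above M' y = (\<Sum>j\<in>J. b j * above (N' j) y)" for y
    unfolding above_def perm_sum_def
    using J M rel' finite_permutations[OF fin(2)]
    by (intro above_base_relation[where A = ?B]) (auto simp: perm_sum_def)
  have "?c * ?l = (\<Sum>\<rho>\<in>?P. below M (x \<circ> \<rho>) * above M' (x \<circ> \<rho>) * ?s (x \<circ> \<rho>))"
    unfolding below_def above_def by (rule product[OF M])
  also have "\<dots> = (\<Sum>\<rho>\<in>?P. \<Sum>i\<in>I. \<Sum>j\<in>J.
      (a i * below (N i) (x \<circ> \<rho>)) * (b j * above (N' j) (x \<circ> \<rho>)) * ?s (x \<circ> \<rho>))"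
    unfolding below above sum_product unfolding sum_distrib_right ..
  also have "\<dots> = (\<Sum>i\<in>I. \<Sum>j\<in>J. \<Sum>\<rho>\<in>?P.
      (a i * below (N i) (x \<circ> \<rho>)) * (b j * above (N' j) (x \<circ> \<rho>)) * ?s (x \<circ> \<rho>))"
    by (subst sum.swap) (intro sum.cong refl sum.swap)
  also have "\<dots> = (\<Sum>i\<in>I. \<Sum>j\<in>J. a i * b j *
      (?c * perm_sum (?A \<union> ?B) (base_indicator (N i \<box> N' j)) x))"
  proof (intro sum.cong refl)
    fix i j assume "i \<in> I" "j \<in> J"
    then have NN: "matroid (N i)" "matroid (N' j)" "ground (N i) \<inter> ground (N' j) = {}"
      "ground (N i) = ?A" "ground (N' j) = ?B" "rank (N i) = rank M" "rank (N' j) = rank M'"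
      using I J M by auto
    have "?c * perm_sum (?A \<union> ?B) (base_indicator (N i \<box> N' j)) x =
        (\<Sum>\<rho>\<in>?P. below (N i) (x \<circ> \<rho>) * above (N' j) (x \<circ> \<rho>) * ?s (x \<circ> \<rho>))"
      unfolding below_def above_def using product[OF NN(1-3), of x] unfolding NN(4-) .
    then show "(\<Sum>\<rho>\<in>?P. (a i * below (N i) (x \<circ> \<rho>)) * (b j * above (N' j) (x \<circ> \<rho>)) * ?s (x \<circ> \<rho>)) =
        a i * b j * (?c * perm_sum (?A \<union> ?B) (base_indicator (N i \<box> N' j)) x)"
      by (simp add: sum_distrib_left mult_ac)
  qed
  also have "\<dots> = ?c * ?r" by (simp add: sum_distrib_left mult_ac)
  finally show ?thesis by simp
qed

text \<open>
  A shift by \<open>n\<close> on \<open>{..<m}\<close>, completed to a bijection of all natural numbers.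
\<close>

lemma ex_bij_shift:
  fixes n m :: nat
  obtains p :: "nat \<Rightarrow> nat" where "bij p" "p ` {..<m} = {n..<n + m}"
proof
  define p where "p i = (if i < m then i + n else if i < m + n then i - m else i)" for i
  define q where "q i = (if i < n then i + m else if i < m + n then i - n else i)" for i
  have "q (p i) = i" "p (q i) = i" for i by (auto simp: p_def q_def)
  then show "bij p" by (intro o_bij[of q]) (auto simp: fun_eq_iff)
  show "p ` {..<m} = {n..<n + m}"
  proof (intro set_eqI iffI)
    fix i assume "i \<in> {n..<n + m}"
    then show "i \<in> p ` {..<m}" by (intro image_eqI[of _ _ "i - n"]) (auto simp: p_def)
  qed (auto simp: p_def)
qed

lemma perm_sum_relation_of_sym_relation:
  fixes a :: "unlabeled \<Rightarrow> int"
  assumes rel: "\<And>x. sym_base_indicator M x =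
      (\<Sum>X\<in>\<X>. of_int (a X) * unlabeled_sym_base_indicator X x)"
    and M: "matroid M" and L: "matroid L" "isomorphic M L"
    and R: "\<And>X. X \<in> \<X> \<Longrightarrow> matroid (R X) \<and> ground (R X) = ground L \<and> X = iso_rel `` {R X}"
    and p: "bij p" "p ` {..<card (ground L)} = ground L"
  shows "perm_sum (ground L) (base_indicator L) z =
    (\<Sum>X\<in>\<X>. of_int (a X) * perm_sum (ground L) (base_indicator (R X)) z)"
proof -
  let ?f = "fact (card (ground L)) :: real"
  have "perm_sum (ground L) (base_indicator L) z / ?f = sym_base_indicator M (z \<circ> p)"
    using sym_base_indicator_eq_perm_sum[OF L(1) p] sym_base_indicator_isomorphic[OF M L] by simp
  also have "\<dots> = (\<Sum>X\<in>\<X>. of_int (a X) * (perm_sum (ground L) (base_indicator (R X)) z / ?f))"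
    unfolding rel
  proof (intro sum.cong refl)
    fix X assume X: "X \<in> \<X>"
    have "unlabeled_sym_base_indicator X = sym_base_indicator (R X)"
      using R[OF X] unlabeled_sym_base_indicator_class[of "R X"] by simp
    then show "of_int (a X) * unlabeled_sym_base_indicator X (z \<circ> p) =
        of_int (a X) * (perm_sum (ground L) (base_indicator (R X)) z / ?f)"
      using sym_base_indicator_eq_perm_sum[of "R X" p z] R[OF X] p by simp
  qed
  also have "\<dots> = (\<Sum>X\<in>\<X>. of_int (a X) * perm_sum (ground L) (base_indicator (R X)) z) / ?f"
    by (simp add: sum_divide_distrib)
  finally show ?thesis by simp
qed

text \<open>
  All matroids are moved to two fixed ground sets, \<open>{..<n}\<close> for \<open>M\<close> and \<open>{n..<n + m}\<close> for \<open>M'\<close>, where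
  their union is again an initial segment.
\<close>

theorem sym_base_indicator_free_product_relation:
  fixes M M' :: "'a set_system" and a b :: "unlabeled \<Rightarrow> int"
  assumes M: "matroid M" "matroid M'" "ground M \<inter> ground M' = {}"
    and rel: "\<And>x. sym_base_indicator M x =
      (\<Sum>X\<in>unlabeled_nested (rank M) (card (ground M)).
        of_int (a X) * unlabeled_sym_base_indicator X x)"
    and rel': "\<And>x. sym_base_indicator M' x =
      (\<Sum>Y\<in>unlabeled_nested (rank M') (card (ground M')).
        of_int (b Y) * unlabeled_sym_base_indicator Y x)"
  shows "sym_base_indicator (M \<box> M') x =
    (\<Sum>X\<in>unlabeled_nested (rank M) (card (ground M)).
      \<Sum>Y\<in>unlabeled_nested (rank M') (card (ground M')).
        of_int (a X * b Y) * unlabeled_sym_base_indicator (X \<box>\<^sub>u Y) x)"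
proof -
  define n where "n = card (ground M)"
  define m where "m = card (ground M')"
  let ?A = "{..<n}" and ?B = "{n..<n + m}"
  let ?\<X> = "unlabeled_nested (rank M) n" and ?\<Y> = "unlabeled_nested (rank M') m"
  have AB: "?A \<inter> ?B = {}" "?A \<union> ?B = {..<n + m}" by auto
  obtain L where L: "matroid L" "isomorphic M L" "ground L = ?A"
    using ex_isomorphic_on[OF M(1), of ?A] by (auto simp: n_def)
  obtain L' where L': "matroid L'" "isomorphic M' L'" "ground L' = ?B"
    using ex_isomorphic_on[OF M(2), of ?B] by (auto simp: m_def)
  note rank = isomorphic_rank[OF M(1) L(1,2)] isomorphic_rank[OF M(2) L'(1,2)]
  obtain R where R: "\<And>X. X \<in> ?\<X> \<Longrightarrow>
      matroid (R X) \<and> ground (R X) = ?A \<and> rank (R X) = rank M \<and> X = iso_rel `` {R X}"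
    using ex_representatives[of ?A "rank M"] by auto
  obtain R' where R': "\<And>Y. Y \<in> ?\<Y> \<Longrightarrow>
      matroid (R' Y) \<and> ground (R' Y) = ?B \<and> rank (R' Y) = rank M' \<and> Y = iso_rel `` {R' Y}"
    using ex_representatives[of ?B "rank M'"] by auto
  obtain p where p: "bij p" "p ` {..<m} = ?B" using ex_bij_shift .
  have sym: "sym_base_indicator N x = perm_sum (?A \<union> ?B) (base_indicator N) x / fact (n + m)"
    if "matroid N" "ground N = ?A \<union> ?B" for N :: "nat set_system"
    using sym_base_indicator_eq_perm_sum[of N id x] that by (simp add: AB)
  have prod: "matroid (P \<box> Q)" "ground (P \<box> Q) = ?A \<union> ?B"
    if "matroid P" "matroid Q" "ground P = ?A" "ground Q = ?B" for P Q
    using matroid_free_product[OF that(1,2)] that AB by (auto simp: free_product_def)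
  have "sym_base_indicator (M \<box> M') x = sym_base_indicator (L \<box> L') x"
    using matroid_free_product[OF M] prod(1)[OF L(1) L'(1) L(3) L'(3)] L L' AB
    by (intro fun_cong[OF sym_base_indicator_isomorphic] isomorphic_free_product M) auto
  also have "\<dots> = perm_sum (?A \<union> ?B) (base_indicator (L \<box> L')) x / fact (n + m)"
    by (rule sym[OF prod]) fact+
  also have "perm_sum (?A \<union> ?B) (base_indicator (L \<box> L')) x =
      (\<Sum>X\<in>?\<X>. \<Sum>Y\<in>?\<Y>. of_int (a X) * of_int (b Y) *
        perm_sum (?A \<union> ?B) (base_indicator (R X \<box> R' Y)) x)"
  proof (rule perm_sum_free_product_relation[OF L(1) L'(1), unfolded L(3) L'(3) rank])
    show "?A \<inter> ?B = {}" by fact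
    show "perm_sum ?A (base_indicator L) z =
        (\<Sum>X\<in>?\<X>. of_int (a X) * perm_sum ?A (base_indicator (R X)) z)" for z
      using R L(3)
      by (intro perm_sum_relation_of_sym_relation[OF rel[folded n_def] M(1) L(1,2),
            where p = id, unfolded L(3)]) auto
    show "perm_sum ?B (base_indicator L') z =
        (\<Sum>Y\<in>?\<Y>. of_int (b Y) * perm_sum ?B (base_indicator (R' Y)) z)" for z
      using R' p
      by (intro perm_sum_relation_of_sym_relation[OF rel'[folded m_def] M(2) L'(1,2),
            where p = p, unfolded L'(3)]) auto
  qed (use R R' finite_unlabeled_nested in auto)
  also have "\<dots> / fact (n + m) = (\<Sum>X\<in>?\<X>. \<Sum>Y\<in>?\<Y>.
      of_int (a X * b Y) * unlabeled_sym_base_indicator (X \<box>\<^sub>u Y) x)"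
    unfolding sum_divide_distrib
  proof (intro sum.cong refl)
    fix X Y assume "X \<in> ?\<X>" "Y \<in> ?\<Y>"
    then have RR: "matroid (R X)" "matroid (R' Y)" "ground (R X) = ?A" "ground (R' Y) = ?B"
      and classes: "X = iso_rel `` {R X}" "Y = iso_rel `` {R' Y}"
      using R R' by blast+
    have "X \<box>\<^sub>u Y = iso_rel `` {R X \<box> R' Y}"
      using unlabeled_free_product_class[of "R X" "R' Y"] RR classes AB by simp
    then have "unlabeled_sym_base_indicator (X \<box>\<^sub>u Y) x = sym_base_indicator (R X \<box> R' Y) x"
      using unlabeled_sym_base_indicator_class[OF prod(1)[OF RR]] by simp
    then show "of_int (a X) * of_int (b Y) * perm_sum (?A \<union> ?B) (base_indicator (R X \<box> R' Y)) x
        / fact (n + m) = of_int (a X * b Y) * unlabeled_sym_base_indicator (X \<box>\<^sub>u Y) x"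
      using sym[OF prod[OF RR]] by simp
  qed
  finally show ?thesis unfolding n_def m_def .
qed

theorem theorem3p1:
  fixes M M' :: "'a set_system"
  assumes "matroid M" and "matroid M'"
    and "ground M \<inter> ground M' = {}"
    and "coloops M = {}" and "loops M' = {}"
  shows
    "(\<forall>(a :: unlabeled \<Rightarrow> int) (b :: unlabeled \<Rightarrow> int).
        (\<forall>x. sym_base_indicator M x =
          (\<Sum>N\<in>unlabeled_nested (rank M) (card (ground M)).
            of_int (a N) * unlabeled_sym_base_indicator N x)) \<longrightarrow>
        (\<forall>x. sym_base_indicator M' x =
          (\<Sum>N'\<in>unlabeled_nested (rank M') (card (ground M')).
            of_int (b N') * unlabeled_sym_base_indicator N' x)) \<longrightarrow>
        (\<forall>x. sym_base_indicator (M \<box> M') x =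
          (\<Sum>N\<in>unlabeled_nested (rank M) (card (ground M)).
            \<Sum>N'\<in>unlabeled_nested (rank M') (card (ground M')).
              of_int (a N * b N') * unlabeled_sym_base_indicator (N \<box>\<^sub>u N') x))) \<and>
     (\<forall>(a :: 'a set_system \<Rightarrow> int) (b :: 'a set_system \<Rightarrow> int).
        (\<forall>x. base_indicator M x =
          (\<Sum>N\<in>labeled_nested (rank M) (ground M). of_int (a N) * base_indicator N x)) \<longrightarrow>
        (\<forall>x. base_indicator M' x =
          (\<Sum>N'\<in>labeled_nested (rank M') (ground M'). of_int (b N') * base_indicator N' x)) \<longrightarrow>
        (\<forall>x. base_indicator (M \<box> M') x =
          (\<Sum>N\<in>labeled_nested (rank M) (ground M).
            \<Sum>N'\<in>labeled_nested (rank M') (ground M').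
              of_int (a N * b N') * base_indicator (N \<box> N') x)))"
proof (intro conjI allI impI)
  fix a b :: "unlabeled \<Rightarrow> int" and x
  assume "\<forall>x. sym_base_indicator M x =
      (\<Sum>N\<in>unlabeled_nested (rank M) (card (ground M)).
        of_int (a N) * unlabeled_sym_base_indicator N x)"
    and "\<forall>x. sym_base_indicator M' x =
      (\<Sum>N'\<in>unlabeled_nested (rank M') (card (ground M')).
        of_int (b N') * unlabeled_sym_base_indicator N' x)"
  then show "sym_base_indicator (M \<box> M') x =
      (\<Sum>N\<in>unlabeled_nested (rank M) (card (ground M)).
        \<Sum>N'\<in>unlabeled_nested (rank M') (card (ground M')).
          of_int (a N * b N') * unlabeled_sym_base_indicator (N \<box>\<^sub>u N') x)"
    by (intro sym_base_indicator_free_product_relation assms) blast+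
next
  fix a b :: "'a set_system \<Rightarrow> int" and x
  assume rel: "\<forall>x. base_indicator M x =
      (\<Sum>N\<in>labeled_nested (rank M) (ground M). of_int (a N) * base_indicator N x)"
    and rel': "\<forall>x. base_indicator M' x =
      (\<Sum>N'\<in>labeled_nested (rank M') (ground M'). of_int (b N') * base_indicator N' x)"
  have "base_indicator (M \<box> M') x =
      (\<Sum>N\<in>labeled_nested (rank M) (ground M). \<Sum>N'\<in>labeled_nested (rank M') (ground M').
        of_int (a N) * of_int (b N') * base_indicator (N \<box> N') x)"
    by (rule base_indicator_free_product_relation[OF assms(1-3)
          finite_labeled_nested _ finite_labeled_nested _ rel[rule_format] rel'[rule_format]])
      (use assms matroid.finite_ground in \<open>auto simp: labeled_nested_def\<close>)
  then show "base_indicator (M \<box> M') x =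
      (\<Sum>N\<in>labeled_nested (rank M) (ground M). \<Sum>N'\<in>labeled_nested (rank M') (ground M').
        of_int (a N * b N') * base_indicator (N \<box> N') x)"
    by simp
qed

end
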